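(* Let $n\ge 3$ and let $b,b'$ be pure $n$-braids. If $b$ and $b'$ are conjugate in $\mathcal{B}_n$, then $F_{\beta}(g;b)=F_{\beta}(g;b')$ (as multisets) for any $n$-tuple of braids $\beta=(b_1,b_2,\dots,b_n)$ and any conjugacy invariant $g$ of braids.
   Context: $\mathcal{B}_n$ denotes the braid group on $n$ strands (strands run monotonically from an upper bar to a lower bar; $bb'$ is $b$ placed above $b'$), and $\mathcal{B}$ is the set of all braids (on any number of strands $\ge 1$). The $i$-th strand $s_i$ is the one whose upper endpoint is in the $i$-th position from the left. A braid is pure if for every $i$ the $i$-th strand ends at the $i$-th lower position. Braids $b,b'\in\mathcal{B}_n$ are conjugate if $b'=a^{-1}ba$ for some $a\in\mathcal{B}_n$. A conjugacy invariant $g$ is a function on $\mathcal{B}$ taking equal values on conjugate braids. For $b\in\mathcal{B}_n$ and $b_i\in\mathcal{B}_{k_i}$ ($k_i\geq 1$), the cabled braid $f(b_1,\dots,b_n;b)\in\mathcal{B}_{k_1+\dots+k_n}$ is obtained from $b$ by replacing each strand $s_i$ with the braid $b_i$ inside a sufficiently small tubular neighborhood of $s_i$; that is, $s_i$ is replaced by $k_i$ parallel (untwisted, parallel in the diagram plane) copies and $b_i$ is inserted in these copies. For an $n$-tuple $\beta=(b_1,\dots,b_n)$ and a permutation $\pi$ of $\{1,\dots,n\}$, write $\pi(\beta)=(b_{\pi(1)},\dots,b_{\pi(n)})$. Then $F_{\beta}(g;b)$ is the multiset with $n!$ entries $$F_{\beta}(g;b)=\{\,g(f(\pi(\beta);b))\mid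 \pi \text{ is a permutation on }\{1,2,\dots,n\}\,\}.$$ *)

theory Defs
  imports "HOL-Analysis.Analysis" "HOL-Algebra.Group" "HOL-Library.Multiset"
begin

section \<open>Geometric braids\<close>

text \<open>
  The space between the bars is \<open>complex \<times> {0..1}\<close>. The second coordinate is the height, running
  from 0 (upper bar) to 1 (lower bar); the real part is the left-to-right coordinate of the diagram
  plane and the imaginary part is the depth. Since strands are monotone they can be parametrized by
  height, so \<open>n\<close> disjoint strands are a path in the space of configurations of \<open>n\<close> distinct labelled
  points of the plane. The positions on both bars are \<open>1, ..., n\<close> on the real axis.

  Configurations are functions on \<open>nat\<close> that vanish outside the index set \<open>{1..n}\<close>.
\<close>

definition config :: "nat \<Rightarrow> (nat \<Rightarrow> complex) set" where
  "config n = {x. inj_on x {1..n} \<and> (\<forall>i. i \<notin> {1..n} \<longrightarrow> x i = 0)}"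

definition base_config :: "nat \<Rightarrow> nat \<Rightarrow> complex" where
  "base_config n = (\<lambda>i. if i \<in> {1..n} then of_nat i else 0)"

text \<open>\<open>\<lambda>t. \<gamma> t i\<close> is the strand whose upper endpoint is in position \<open>i\<close>.\<close>

definition geometric_braid :: "nat \<Rightarrow> (real \<Rightarrow> nat \<Rightarrow> complex) \<Rightarrow> bool" where
  "geometric_braid n \<gamma> \<longleftrightarrow>
     1 \<le> n \<and> path \<gamma> \<and> path_image \<gamma> \<subseteq> config n \<and> pathstart \<gamma> = base_config n \<and>
     (\<exists>\<sigma>. \<sigma> permutes {1..n} \<and> pathfinish \<gamma> = base_config n \<circ> \<sigma>)"

definition end_perm :: "nat \<Rightarrow> (real \<Rightarrow> nat \<Rightarrow> complex) \<Rightarrow> nat \<Rightarrow> nat" where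
  "end_perm n \<gamma> = (THE \<sigma>. \<sigma> permutes {1..n} \<and> pathfinish \<gamma> = base_config n \<circ> \<sigma>)"

text \<open>Isotopy of braids is homotopy of paths relative to the endpoints; two braids on different
  numbers of strands are never isotopic.\<close>

fun isotopic :: "nat \<times> (real \<Rightarrow> nat \<Rightarrow> complex) \<Rightarrow> nat \<times> (real \<Rightarrow> nat \<Rightarrow> complex) \<Rightarrow> bool" where
  "isotopic (n, \<gamma>) (m, \<delta>) \<longleftrightarrow>
     n = m \<and> geometric_braid n \<gamma> \<and> geometric_braid n \<delta> \<and> homotopic_paths (config n) \<gamma> \<delta>"

lemma base_in_config: "base_config n \<in> config n"
  by (auto simp: config_def base_config_def inj_on_def)

lemma config_permutes: "x \<in> config n \<Longrightarrow> \<sigma> permutes {1..n} \<Longrightarrow> x \<circ> \<sigma> \<in> config n"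
  unfolding config_def
  by (auto simp: permutes_in_image permutes_inj_on permutes_not_in permutes_image
      intro!: comp_inj_on)

lemma geometric_braid_const: "1 \<le> n \<Longrightarrow> geometric_braid n (\<lambda>t. base_config n)"
  unfolding geometric_braid_def
  using base_in_config permutes_id
  by (auto simp: path_def path_image_def pathstart_def pathfinish_def intro!: exI[of _ id])

lemma base_config_comp_inj:
  assumes "\<sigma> permutes {1..n}" "\<tau> permutes {1..n}"
    and "base_config n \<circ> \<sigma> = base_config n \<circ> \<tau>"
  shows "\<sigma> = \<tau>"
proof
  fix i
  show "\<sigma> i = \<tau> i"
  proof (cases "i \<in> {1..n}")
    case True
    then have "\<sigma> i \<in> {1..n}" "\<tau> i \<in> {1..n}"
      using assms by (meson permutes_in_image)+
    then show ?thesis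
      using fun_cong[OF assms(3), of i] by (simp add: base_config_def)
  qed (use assms in \<open>auto simp: permutes_not_in\<close>)
qed

lemma end_perm_eqI:
  assumes "\<sigma> permutes {1..n}" "pathfinish \<gamma> = base_config n \<circ> \<sigma>"
  shows "end_perm n \<gamma> = \<sigma>"
  unfolding end_perm_def using assms base_config_comp_inj by (intro the_equality) auto

lemma end_perm:
  assumes "geometric_braid n \<gamma>"
  shows "end_perm n \<gamma> permutes {1..n}" "pathfinish \<gamma> = base_config n \<circ> end_perm n \<gamma>"
  using assms end_perm_eqI unfolding geometric_braid_def by metis+

lemma path_relabel:
  fixes \<gamma> :: "real \<Rightarrow> nat \<Rightarrow> complex"
  assumes "path \<gamma>"
  shows "path (\<lambda>t. \<gamma> t \<circ> \<sigma>)"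
  using assms unfolding path_def comp_def
  by (intro continuous_on_coordinatewise_then_product) (rule continuous_on_product_then_coordinatewise)

lemma path_image_relabel:
  "path_image \<gamma> \<subseteq> config n \<Longrightarrow> \<sigma> permutes {1..n} \<Longrightarrow> path_image (\<lambda>t. \<gamma> t \<circ> \<sigma>) \<subseteq> config n"
  unfolding path_image_def using config_permutes by blast

lemma homotopic_relabel:
  assumes "homotopic_paths (config n) \<gamma> \<delta>" "\<sigma> permutes {1..n}"
  shows "homotopic_paths (config n) (\<lambda>t. \<gamma> t \<circ> \<sigma>) (\<lambda>t. \<delta> t \<circ> \<sigma>)"
proof -
  have "continuous_on (config n) (\<lambda>x. x \<circ> \<sigma>)"
    unfolding comp_def
    by (intro continuous_on_coordinatewise_then_product)
      (rule continuous_on_product_then_coordinatewise[OF continuous_on_id])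
  then have "homotopic_paths (config n) ((\<lambda>x. x \<circ> \<sigma>) \<circ> \<gamma>) ((\<lambda>x. x \<circ> \<sigma>) \<circ> \<delta>)"
    by (rule homotopic_paths_continuous_image[OF assms(1)]) (use assms(2) config_permutes in auto)
  then show ?thesis by (simp add: comp_def)
qed

text \<open>Stacking \<open>\<gamma>\<close> above \<open>\<delta>\<close>: the strand of \<open>\<gamma>\<close> ending in position \<open>j\<close> is continued by the
  \<open>j\<close>-th strand of \<open>\<delta>\<close>.\<close>

definition stack :: "nat \<Rightarrow> (real \<Rightarrow> nat \<Rightarrow> complex) \<Rightarrow> (real \<Rightarrow> nat \<Rightarrow> complex) \<Rightarrow> (real \<Rightarrow> nat \<Rightarrow> complex)" where
  "stack n \<gamma> \<delta> = \<gamma> +++ (\<lambda>t. \<delta> t \<circ> end_perm n \<gamma>)"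

lemma stack_ends:
  assumes "geometric_braid n \<gamma>" "geometric_braid n \<delta>"
  shows "pathfinish \<gamma> = pathstart (\<lambda>t. \<delta> t \<circ> end_perm n \<gamma>)"
    and "pathfinish (stack n \<gamma> \<delta>) = base_config n \<circ> (end_perm n \<delta> \<circ> end_perm n \<gamma>)"
  using end_perm(2)[OF assms(1)] end_perm(2)[OF assms(2)] assms(2)
  by (auto simp: stack_def geometric_braid_def pathstart_def pathfinish_def joinpaths_def o_assoc)

lemma geometric_braid_stack:
  assumes "geometric_braid n \<gamma>" "geometric_braid n \<delta>"
  shows "geometric_braid n (stack n \<gamma> \<delta>)" "end_perm n (stack n \<gamma> \<delta>) = end_perm n \<delta> \<circ> end_perm n \<gamma>"
proof -
  note p = end_perm(1)[OF assms(1)] end_perm(1)[OF assms(2)]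
  have c: "end_perm n \<delta> \<circ> end_perm n \<gamma> permutes {1..n}"
    using p by (rule permutes_compose)
  have "path (stack n \<gamma> \<delta>)"
    using assms stack_ends(1)[OF assms] path_relabel
    unfolding stack_def geometric_braid_def by (metis path_join)
  moreover have "path_image (stack n \<gamma> \<delta>) \<subseteq> config n"
    using assms p path_image_relabel path_image_join_subset
    unfolding stack_def geometric_braid_def by (metis subset_path_image_join)
  ultimately show "geometric_braid n (stack n \<gamma> \<delta>)"
    using c assms stack_ends(2)[OF assms] unfolding geometric_braid_def
    by (auto simp: stack_def)
  show "end_perm n (stack n \<gamma> \<delta>) = end_perm n \<delta> \<circ> end_perm n \<gamma>"
    using c stack_ends(2)[OF assms] by (rule end_perm_eqI)
qed

lemma isotopic_end_perm: "isotopic (n, \<gamma>) (n, \<gamma>') \<Longrightarrow> end_perm n \<gamma> = end_perm n \<gamma>'"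
  unfolding end_perm_def using homotopic_paths_imp_pathfinish by fastforce

lemma isotopic_stack:
  assumes "isotopic (n, \<gamma>) (n, \<gamma>')" "isotopic (n, \<delta>) (n, \<delta>')"
  shows "isotopic (n, stack n \<gamma> \<delta>) (n, stack n \<gamma>' \<delta>')"
proof -
  have g: "geometric_braid n \<gamma>" "geometric_braid n \<gamma>'" "geometric_braid n \<delta>" "geometric_braid n \<delta>'"
    using assms by auto
  have "homotopic_paths (config n) (stack n \<gamma> \<delta>) (stack n \<gamma>' \<delta>')"
    unfolding stack_def isotopic_end_perm[OF assms(1), symmetric]
    using assms homotopic_relabel[OF _ end_perm(1)[OF g(1)]] stack_ends(1)[OF g(1) g(3)]
    by (intro homotopic_paths_join) auto
  then show ?thesis using g geometric_braid_stack by auto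
qed


section \<open>Braids and the braid groups\<close>

quotient_type braid = "nat \<times> (real \<Rightarrow> nat \<Rightarrow> complex)" / partial: isotopic
proof (rule part_equivpI)
  show "\<exists>x. isotopic x x"
    using geometric_braid_const[of 1]
    by (intro exI[of _ "(1, \<lambda>t. base_config 1)"]) (auto simp: geometric_braid_def)
  show "symp isotopic"
    by (auto simp: symp_def homotopic_paths_sym)
  show "transp isotopic"
    by (auto simp: transp_def intro: homotopic_paths_trans)
qed

lift_definition strands :: "braid \<Rightarrow> nat" is fst
  by auto

lift_definition pure_braid :: "braid \<Rightarrow> bool" is
  "\<lambda>(n, \<gamma>). \<forall>i\<in>{1..n}. pathfinish \<gamma> i = of_nat i"
  using homotopic_paths_imp_pathfinish by fastforce

text \<open>The value for different numbers of strands is irrelevant.\<close>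

lift_definition braid_mult :: "braid \<Rightarrow> braid \<Rightarrow> braid" is
  "\<lambda>(n, \<gamma>) (m, \<delta>). if m = n then (n, stack n \<gamma> \<delta>) else (n, \<gamma>)"
  using isotopic_stack by (auto split: prod.splits simp del: isotopic.simps) auto

definition represents :: "nat \<Rightarrow> (real \<Rightarrow> nat \<Rightarrow> complex) \<Rightarrow> braid \<Rightarrow> bool" where
  "represents n \<gamma> b \<longleftrightarrow> geometric_braid n \<gamma> \<and> abs_braid (n, \<gamma>) = b"

definition trivial_braid :: "nat \<Rightarrow> braid" where
  "trivial_braid n = abs_braid (n, \<lambda>t. base_config n)"

definition braid_group :: "nat \<Rightarrow> braid monoid" where
  "braid_group n = \<lparr>carrier = {b. strands b = n}, mult = braid_mult, one = trivial_braid n\<rparr>"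

lemma isotopic_self: "geometric_braid n \<gamma> \<Longrightarrow> isotopic (n, \<gamma>) (n, \<gamma>)"
  by (simp add: geometric_braid_def)

lemma braid_cases:
  obtains n \<gamma> where "represents n \<gamma> b"
proof -
  obtain n \<gamma> where r: "rep_braid b = (n, \<gamma>)" by fastforce
  have "isotopic (n, \<gamma>) (n, \<gamma>)" "abs_braid (n, \<gamma>) = b"
    using Quotient3_rep_reflp[OF Quotient3_braid, of b] Quotient3_abs_rep[OF Quotient3_braid, of b]
    by (simp_all add: r)
  then show ?thesis using that[of n \<gamma>] by (auto simp: represents_def)
qed

lemma strands_abs: "geometric_braid n \<gamma> \<Longrightarrow> strands (abs_braid (n, \<gamma>)) = n"
  using strands.abs_eq[OF isotopic_self] by simp

lemma abs_braid_eqI: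
  "geometric_braid n \<gamma> \<Longrightarrow> geometric_braid n \<delta> \<Longrightarrow> homotopic_paths (config n) \<gamma> \<delta> \<Longrightarrow>
    abs_braid (n, \<gamma>) = abs_braid (n, \<delta>)"
  using Quotient3_rel[OF Quotient3_braid, of "(n, \<gamma>)" "(n, \<delta>)"] isotopic_self by simp

lemma braid_mult_abs:
  "geometric_braid n \<gamma> \<Longrightarrow> geometric_braid n \<delta> \<Longrightarrow>
    braid_mult (abs_braid (n, \<gamma>)) (abs_braid (n, \<delta>)) = abs_braid (n, stack n \<gamma> \<delta>)"
  using braid_mult.abs_eq[OF isotopic_self isotopic_self, of n \<gamma> n \<delta>] by simp

lemma homotopic_const_join:
  fixes p :: "real \<Rightarrow> 'a::topological_space"
  assumes "path p" "path_image p \<subseteq> S"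
  shows "homotopic_paths S ((\<lambda>t. pathstart p) +++ p) p"
proof -
  have "continuous_on ({..1/2} \<union> {1/2..}) (\<lambda>t::real. if t \<le> 1/2 then 0 else 2 * t - 1)"
    by (rule continuous_on_If) (auto intro!: continuous_intros)
  then have c: "continuous_on {0..1} (\<lambda>t::real. if t \<le> 1/2 then 0 else 2 * t - 1)"
    by (rule continuous_on_subset) auto
  have "homotopic_paths S p ((\<lambda>t. pathstart p) +++ p)"
    by (rule homotopic_paths_reparametrize[OF assms c]) (auto simp: joinpaths_def pathstart_def)
  then show ?thesis by (rule homotopic_paths_sym)
qed

lemma homotopic_join_reversepath:
  fixes p :: "real \<Rightarrow> 'a::topological_space"
  assumes "path p" "path_image p \<subseteq> S"
  shows "homotopic_paths S (reversepath p +++ p) (\<lambda>t. pathfinish p)"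
proof -
  have eq: "(reversepath p +++ p) = (\<lambda>t. p \<bar>2 * t - 1\<bar>)"
    by (auto simp: joinpaths_def reversepath_def abs_if fun_eq_iff intro!: arg_cong[of _ _ p])
  let ?h = "\<lambda>z::real \<times> real. fst z + (1 - fst z) * \<bar>2 * snd z - 1\<bar>"
  have h: "?h z \<in> {0..1}" if "z \<in> {0..1} \<times> {0..1}" for z
  proof -
    have "\<bar>2 * snd z - 1\<bar> \<le> 1" using that by auto
    moreover have "0 \<le> fst z" "fst z \<le> 1" using that by auto
    ultimately show ?thesis
      using mult_left_mono[of "\<bar>2 * snd z - 1\<bar>" 1 "1 - fst z"] by auto
  qed
  have "continuous_on ({0..1} \<times> {0..1}) (p \<circ> ?h)"
  proof (rule continuous_on_compose)
    show "continuous_on ({0..1} \<times> {0..1}) ?h"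
      by (intro continuous_intros)
    show "continuous_on (?h ` ({0..1} \<times> {0..1})) p"
      using assms(1) h unfolding path_def by (blast intro: continuous_on_subset)
  qed
  moreover have "(p \<circ> ?h) ` ({0..1} \<times> {0..1}) \<subseteq> S"
    using assms(2) h unfolding path_image_def by (simp add: image_subset_iff)
  ultimately show ?thesis
    unfolding eq homotopic_paths
    by (intro exI[of _ "p \<circ> ?h"]) (simp add: pathstart_def pathfinish_def Pi_iff image_subset_iff)
qed

lemma geometric_braid_reverse:
  assumes "geometric_braid n \<gamma>"
  defines "\<delta> \<equiv> (\<lambda>t. reversepath \<gamma> t \<circ> Hilbert_Choice.inv (end_perm n \<gamma>))"
  shows "geometric_braid n \<delta>" "end_perm n \<delta> = Hilbert_Choice.inv (end_perm n \<gamma>)"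
    and "isotopic (n, stack n \<delta> \<gamma>) (n, \<lambda>t. base_config n)"
proof -
  let ?i = "Hilbert_Choice.inv (end_perm n \<gamma>)"
  note p = end_perm[OF assms(1)]
  have i: "?i permutes {1..n}" using p(1) by (rule permutes_inv)
  have fin: "pathfinish \<delta> = base_config n \<circ> ?i"
    using assms(1) by (simp add: \<delta>_def pathfinish_def reversepath_def geometric_braid_def pathstart_def)
  have start: "pathstart \<delta> = base_config n"
    using p permutes_inv_o(1)[OF p(1)]
    by (simp add: \<delta>_def pathfinish_def reversepath_def pathstart_def o_assoc[symmetric])
  have path: "path (reversepath \<gamma>)" "path_image (reversepath \<gamma>) \<subseteq> config n"
    using assms(1) by (auto simp: geometric_braid_def)
  show g: "geometric_braid n \<delta>"
    unfolding geometric_braid_def using start fin i assms(1)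
      path_relabel[OF path(1), of ?i] path_image_relabel[OF path(2) i]
    by (auto simp: \<delta>_def geometric_braid_def)
  show e: "end_perm n \<delta> = ?i" using i fin by (rule end_perm_eqI)
  let ?q = "\<lambda>t. \<gamma> t \<circ> ?i"
  have q: "path ?q" "path_image ?q \<subseteq> config n"
    using assms(1) path_relabel path_image_relabel[OF _ i] by (auto simp: geometric_braid_def)
  have "stack n \<delta> \<gamma> = reversepath ?q +++ ?q"
    unfolding stack_def e by (simp add: \<delta>_def reversepath_def)
  moreover have "pathfinish ?q = base_config n"
    using start by (simp add: \<delta>_def pathfinish_def reversepath_def pathstart_def)
  ultimately have "homotopic_paths (config n) (stack n \<delta> \<gamma>) (\<lambda>t. base_config n)"
    using homotopic_join_reversepath[OF q] by simp
  then show "isotopic (n, stack n \<delta> \<gamma>) (n, \<lambda>t. base_config n)"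
    using geometric_braid_stack(1)[OF g assms(1)] assms(1) geometric_braid_const
    by (auto simp: geometric_braid_def)
qed

lemma group_braid_group:
  assumes "1 \<le> n"
  shows "group (braid_group n)"
proof -
  have rep: "\<exists>\<gamma>. geometric_braid n \<gamma> \<and> b = abs_braid (n, \<gamma>)" if "strands b = n" for b
    using that strands_abs unfolding represents_def by (metis braid_cases represents_def)
  note const = geometric_braid_const[OF assms]
  have const_perm: "end_perm n (\<lambda>t. base_config n) = id"
    by (rule end_perm_eqI) (auto simp: permutes_id pathfinish_def)
  show ?thesis
  proof (rule groupI)
    fix x y
    assume "x \<in> carrier (braid_group n)" "y \<in> carrier (braid_group n)"
    then obtain \<gamma> \<delta> where g: "geometric_braid n \<gamma>" "geometric_braid n \<delta>"
      and xy: "x = abs_braid (n, \<gamma>)" "y = abs_braid (n, \<delta>)"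
      using rep unfolding braid_group_def by auto metis
    show "x \<otimes>\<^bsub>braid_group n\<^esub> y \<in> carrier (braid_group n)"
      using g strands_abs[OF geometric_braid_stack(1)[OF g]]
      by (simp add: xy braid_group_def braid_mult_abs)
  next
    show "\<one>\<^bsub>braid_group n\<^esub> \<in> carrier (braid_group n)"
      using strands_abs[OF const] by (simp add: braid_group_def trivial_braid_def)
  next
    fix x y z
    assume "x \<in> carrier (braid_group n)" "y \<in> carrier (braid_group n)" "z \<in> carrier (braid_group n)"
    then obtain \<gamma> \<delta> \<eta> where g: "geometric_braid n \<gamma>" "geometric_braid n \<delta>" "geometric_braid n \<eta>"
      and xyz: "x = abs_braid (n, \<gamma>)" "y = abs_braid (n, \<delta>)" "z = abs_braid (n, \<eta>)"
      using rep unfolding braid_group_def by auto metis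
    note s = geometric_braid_stack[OF g(1) g(2)] geometric_braid_stack[OF g(2) g(3)]
    let ?d = "\<lambda>t. \<delta> t \<circ> end_perm n \<gamma>"
    let ?e = "\<lambda>t. \<eta> t \<circ> end_perm n \<delta> \<circ> end_perm n \<gamma>"
    have 1: "stack n (stack n \<gamma> \<delta>) \<eta> = (\<gamma> +++ ?d) +++ ?e"
      unfolding stack_def[of n "stack n \<gamma> \<delta>"] s(2) by (simp add: stack_def o_assoc)
    have 2: "stack n \<gamma> (stack n \<delta> \<eta>) = \<gamma> +++ ?d +++ ?e"
      unfolding stack_def by (auto simp: joinpaths_def fun_eq_iff)
    have p: "path \<gamma>" "path_image \<gamma> \<subseteq> config n" "path \<delta>" "path_image \<delta> \<subseteq> config n"
      "path \<eta>" "path_image \<eta> \<subseteq> config n"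
      using g by (auto simp: geometric_braid_def)
    have d: "path ?d" "path_image ?d \<subseteq> config n"
      using path_relabel path_image_relabel p end_perm(1)[OF g(1)] by blast+
    have e: "path ?e" "path_image ?e \<subseteq> config n"
      using path_relabel[OF path_relabel[OF p(5)]]
        path_image_relabel[OF path_image_relabel[OF p(6) end_perm(1)[OF g(2)]] end_perm(1)[OF g(1)]]
      by auto
    have f: "pathfinish \<gamma> = pathstart ?d" "pathfinish ?d = pathstart ?e"
      using stack_ends(1)[OF g(1) g(2)] stack_ends(1)[OF g(2) g(3)]
      by (auto simp: pathfinish_def pathstart_def)
    have "abs_braid (n, stack n (stack n \<gamma> \<delta>) \<eta>) = abs_braid (n, stack n \<gamma> (stack n \<delta> \<eta>))"
    proof (rule abs_braid_eqI)
      show "homotopic_paths (config n) (stack n (stack n \<gamma> \<delta>) \<eta>) (stack n \<gamma> (stack n \<delta> \<eta>))"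
        unfolding 1 2
        by (rule homotopic_paths_sym[OF homotopic_paths_assoc[OF p(1,2) d e f]])
    qed (use s g geometric_braid_stack in auto)
    then show "x \<otimes>\<^bsub>braid_group n\<^esub> y \<otimes>\<^bsub>braid_group n\<^esub> z =
        x \<otimes>\<^bsub>braid_group n\<^esub> (y \<otimes>\<^bsub>braid_group n\<^esub> z)"
      using g s by (simp add: xyz braid_group_def braid_mult_abs)
  next
    fix x
    assume "x \<in> carrier (braid_group n)"
    then obtain \<gamma> where g: "geometric_braid n \<gamma>" and x: "x = abs_braid (n, \<gamma>)"
      using rep unfolding braid_group_def by auto
    have "stack n (\<lambda>t. base_config n) \<gamma> = (\<lambda>t. pathstart \<gamma>) +++ \<gamma>"
      using g by (simp add: stack_def const_perm geometric_braid_def)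
    then have "abs_braid (n, stack n (\<lambda>t. base_config n) \<gamma>) = abs_braid (n, \<gamma>)"
      using g geometric_braid_stack(1)[OF const g] homotopic_const_join[of \<gamma> "config n"]
      by (intro abs_braid_eqI) (simp_all add: geometric_braid_def)
    then show "\<one>\<^bsub>braid_group n\<^esub> \<otimes>\<^bsub>braid_group n\<^esub> x = x"
      using g const by (simp add: x braid_group_def trivial_braid_def braid_mult_abs)
    note r = geometric_braid_reverse[OF g]
    let ?y = "abs_braid (n, \<lambda>t. reversepath \<gamma> t \<circ> Hilbert_Choice.inv (end_perm n \<gamma>))"
    have "?y \<otimes>\<^bsub>braid_group n\<^esub> x = \<one>\<^bsub>braid_group n\<^esub>"
      using abs_braid_eqI[OF _ const] r(3)
      by (simp add: x braid_group_def trivial_braid_def braid_mult_abs[OF r(1) g])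
    moreover have "?y \<in> carrier (braid_group n)"
      using strands_abs[OF r(1)] by (simp add: braid_group_def)
    ultimately show "\<exists>y\<in>carrier (braid_group n). y \<otimes>\<^bsub>braid_group n\<^esub> x = \<one>\<^bsub>braid_group n\<^esub>"
      by blast
  qed
qed

definition conjugate :: "braid \<Rightarrow> braid \<Rightarrow> bool" where
  "conjugate b b' \<longleftrightarrow>
     (\<exists>n. b \<in> carrier (braid_group n) \<and> b' \<in> carrier (braid_group n) \<and>
       (\<exists>a\<in>carrier (braid_group n).
          b' = inv\<^bsub>braid_group n\<^esub> a \<otimes>\<^bsub>braid_group n\<^esub> b \<otimes>\<^bsub>braid_group n\<^esub> a))"

definition conjugacy_invariant :: "(braid \<Rightarrow> 'a) \<Rightarrow> bool" where
  "conjugacy_invariant g \<longleftrightarrow> (\<forall>b b'. conjugate b b' \<longrightarrow> g b = g b')"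


section \<open>Cabling\<close>

text \<open>
  If strand \<open>i\<close> is replaced by \<open>k i\<close> parallel strands, the strands of the cable are numbered from
  left to right at the top: strand number \<open>p\<close> is the \<open>(p - cable_offset k j)\<close>-th one of the copies
  of strand \<open>j = cable_block k p\<close>.
\<close>

definition cable_offset :: "(nat \<Rightarrow> nat) \<Rightarrow> nat \<Rightarrow> nat" where
  "cable_offset k j = (\<Sum>i\<in>{1..<j}. k i)"

definition cable_block :: "(nat \<Rightarrow> nat) \<Rightarrow> nat \<Rightarrow> nat" where
  "cable_block k p = (LEAST j. p \<le> (\<Sum>i\<in>{1..j}. k i))"

text \<open>
  At each height a copy of the configuration \<open>\<delta> j t\<close>, scaled by \<open>\<epsilon>\<close>, is placed at the point
  \<open>\<gamma> t j\<close>. The copy is only translated, never rotated, so a trivial \<open>\<delta> j\<close> yields copies of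
  strand \<open>j\<close> that are parallel in the diagram plane (the real direction).
\<close>

definition cable_path ::
  "nat \<Rightarrow> (nat \<Rightarrow> nat) \<Rightarrow> real \<Rightarrow> (nat \<Rightarrow> real \<Rightarrow> nat \<Rightarrow> complex) \<Rightarrow> (real \<Rightarrow> nat \<Rightarrow> complex) \<Rightarrow>
   (real \<Rightarrow> nat \<Rightarrow> complex)" where
  "cable_path n k \<epsilon> \<delta> \<gamma> = (\<lambda>t p.
     if p \<in> {1..(\<Sum>i\<in>{1..n}. k i)} then
       let j = cable_block k p in \<gamma> t j + \<epsilon> *\<^sub>R \<delta> j t (p - cable_offset k j)
     else 0)"

text \<open>
  The endpoints of \<open>cable_path\<close> lie on the bars, but not in the positions \<open>1, ..., N\<close>. They are
  slid there along the bars in a straight way, preserving their left-to-right order.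
\<close>

definition slide :: "(nat \<Rightarrow> complex) \<Rightarrow> (nat \<Rightarrow> complex) \<Rightarrow> (real \<Rightarrow> nat \<Rightarrow> complex)" where
  "slide x y = (\<lambda>t p. linepath (x p) (y p) t)"

definition rank_config :: "nat \<Rightarrow> (nat \<Rightarrow> complex) \<Rightarrow> (nat \<Rightarrow> complex)" where
  "rank_config N x =
     (\<lambda>p. if p \<in> {1..N} then of_nat (card {q\<in>{1..N}. Re (x q) \<le> Re (x p)}) else 0)"

definition standardize :: "nat \<Rightarrow> (real \<Rightarrow> nat \<Rightarrow> complex) \<Rightarrow> (real \<Rightarrow> nat \<Rightarrow> complex)" where
  "standardize N \<gamma> =
     slide (rank_config N (pathstart \<gamma>)) (pathstart \<gamma>) +++ \<gamma> +++
     slide (pathfinish \<gamma>) (rank_config N (pathfinish \<gamma>))"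

text \<open>
  \<open>cabled \<beta> b\<close> is \<open>f(\<beta> 1, ..., \<beta> n; b)\<close>, where \<open>n = strands b\<close>: the braid obtained from any choice
  of representatives, for all sufficiently small \<open>\<epsilon> > 0\<close> (how small depends on the representatives).
  Only the values of \<open>\<beta>\<close> on \<open>{1..n}\<close> matter.
\<close>

definition cabled :: "(nat \<Rightarrow> braid) \<Rightarrow> braid \<Rightarrow> braid" where
  "cabled \<beta> b =
     (let n = strands b; k = (\<lambda>i. strands (\<beta> i)); N = (\<Sum>i\<in>{1..n}. k i) in
      THE c. \<forall>\<gamma> \<delta>. represents n \<gamma> b \<and> (\<forall>i\<in>{1..n}. represents (k i) (\<delta> i) (\<beta> i)) \<longrightarrow>
        (\<forall>\<^sub>F \<epsilon> in at_right 0. represents N (standardize N (cable_path n k \<epsilon> \<delta> \<gamma>)) c))"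

definition cable_invariants :: "(nat \<Rightarrow> braid) \<Rightarrow> (braid \<Rightarrow> 'a) \<Rightarrow> braid \<Rightarrow> 'a multiset" where
  "cable_invariants \<beta> g b =
     image_mset (\<lambda>\<pi>. g (cabled (\<beta> \<circ> \<pi>) b)) (mset_set {\<pi>. \<pi> permutes {1..strands b}})"

end

theory Submission
  imports Defs
begin

text \<open>
  Let \<open>b' = a\<inverse> b a\<close> with \<open>b\<close> and \<open>b'\<close> pure, and let \<open>\<sigma>\<close> be the permutation of \<open>a\<close>. In the diagram of
  \<open>b'\<close> the strand that starts in position \<open>i\<close> first runs through \<open>a\<inverse>\<close>, then along strand
  \<open>\<sigma>\<inverse> i\<close> of \<open>b\<close>, and then back through \<open>a\<close>. Slide the inserted braid \<open>\<beta> i\<close> into the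
  middle part: the cable of \<open>b'\<close> becomes the cable of \<open>b\<close>, with \<open>\<beta> i\<close> inserted in strand
  \<open>\<sigma>\<inverse> i\<close>, transported along a parallel cable of \<open>a\<close>. Hence \<open>f(\<beta>; b')\<close> is conjugate to
  \<open>f(\<beta> \<circ> \<sigma>; b)\<close> (lemma \<open>conjugate_cabled\<close>). Applied to all \<open>\<beta> \<circ> \<pi>\<close>, this matches the entry
  of \<open>\<pi>\<close> in the multiset of \<open>b'\<close> with the entry of \<open>\<pi> \<circ> \<sigma>\<close> in the multiset of \<open>b\<close>, and
  \<open>\<pi> \<mapsto> \<pi> \<circ> \<sigma>\<close> is a bijection on permutations.

  Everything takes place in the space of labelled configurations, where a braid with permutation
  \<open>\<tau>\<close> is a path from a configuration \<open>x\<close> to \<open>x \<circ> \<tau>\<close>. Such a path, based at any \<open>x\<close> and with any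
  labelling of the points, determines a conjugacy class; this is the content of
  \<open>conjugate_transport\<close>. The cables of \<open>b\<close> and \<open>b'\<close> number their strands differently, and the
  renumbering is the relabelling to which that lemma is applied.

  The second ingredient is that cabling a pure braid is well defined, so that its value can be
  read off from convenient representatives (\<open>represents_cabled\<close>). A homotopy of the braid and
  homotopies of the inserted braids combine, for small \<open>\<epsilon>\<close>, to a homotopy of the cables: by
  compactness the distances between different strands are bounded below along the whole homotopy.
  Moving \<open>\<epsilon>\<close> at the same time shows that the choice of \<open>\<epsilon>\<close> is immaterial as well.
\<close>

section \<open>Relabelled paths and conjugation by a change of base point\<close>

lemma relabel_ends:
  "pathstart (\<lambda>t. \<gamma> t \<circ> \<sigma>) = pathstart \<gamma> \<circ> \<sigma>" "pathfinish (\<lambda>t. \<gamma> t \<circ> \<sigma>) = pathfinish \<gamma> \<circ> \<sigma>"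
  by (simp_all add: pathstart_def pathfinish_def)

lemma relabel_join: "(\<lambda>t. (\<gamma> +++ \<delta>) t \<circ> \<sigma>) = (\<lambda>t. \<gamma> t \<circ> \<sigma>) +++ (\<lambda>t. \<delta> t \<circ> \<sigma>)"
  by (simp add: joinpaths_def fun_eq_iff)

lemma relabel_reversepath: "(\<lambda>t. reversepath \<gamma> t \<circ> \<sigma>) = reversepath (\<lambda>t. \<gamma> t \<circ> \<sigma>)"
  by (simp add: reversepath_def)

lemma homotopic_join_cancel:
  fixes q r :: "real \<Rightarrow> 'a::topological_space"
  assumes "path q" "path_image q \<subseteq> S" "path r" "path_image r \<subseteq> S" "pathfinish q = pathstart r"
  shows "homotopic_paths S (reversepath q +++ q +++ r) r"
proof -
  have "homotopic_paths S (reversepath q +++ q +++ r) ((reversepath q +++ q) +++ r)"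
    using assms by (intro homotopic_paths_assoc) auto
  moreover have "homotopic_paths S \<dots> ((\<lambda>t. pathstart r) +++ r)"
    using homotopic_join_reversepath[OF assms(1,2)] assms by (intro homotopic_paths_join) auto
  moreover have "homotopic_paths S \<dots> r"
    using assms by (intro homotopic_const_join)
  ultimately show ?thesis by (metis homotopic_paths_trans)
qed

lemma geometric_braidI:
  assumes "1 \<le> N" "\<tau> permutes {1..N}" "path \<gamma>" "path_image \<gamma> \<subseteq> config N"
    and "pathstart \<gamma> = base_config N" "pathfinish \<gamma> = base_config N \<circ> \<tau>"
  shows "geometric_braid N \<gamma>" "end_perm N \<gamma> = \<tau>"
  using assms end_perm_eqI unfolding geometric_braid_def by auto

lemma conjugateI:
  assumes "strands a = n" "strands c = n" "strands c' = n"
    and "1 \<le> n" "braid_mult c a = braid_mult a c'"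
  shows "conjugate c c'"
proof -
  interpret group "braid_group n"
    using assms group_braid_group by blast
  have car: "a \<in> carrier (braid_group n)" "c \<in> carrier (braid_group n)" "c' \<in> carrier (braid_group n)"
    using assms by (auto simp: braid_group_def)
  have "c \<otimes>\<^bsub>braid_group n\<^esub> a = a \<otimes>\<^bsub>braid_group n\<^esub> c'"
    using assms by (simp add: braid_group_def)
  then have "c' = inv\<^bsub>braid_group n\<^esub> a \<otimes>\<^bsub>braid_group n\<^esub> (c \<otimes>\<^bsub>braid_group n\<^esub> a)"
    using car by (simp add: inv_solve_left)
  then show ?thesis
    unfolding conjugate_def
    using car m_assoc[of "inv\<^bsub>braid_group n\<^esub> a" c a]
    by (intro exI[of _ n] conjI bexI[of _ a]) auto
qed

text \<open>
  Paths \<open>p\<close> from \<open>x\<close> to \<open>x \<circ> \<tau>\<close> are loops in the space of unlabelled configurations. Joining the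
  base configuration to \<open>x\<close> in two ways, along \<open>u\<close> and along \<open>v\<close>, gives braids that are conjugate by
  the braid \<open>u v\<inverse>\<close>. The end of \<open>v\<close> may carry other labels than \<open>x\<close>; then \<open>p\<close> is relabelled by
  \<open>\<rho>\<close>, and the hypothesis on \<open>\<tau> \<circ> \<rho>\<close> says that \<open>\<tau>'\<close> is \<open>\<tau>\<close> in the new labels.
\<close>

lemma conjugate_transport:
  assumes N: "1 \<le> N" and perms: "\<tau> permutes {1..N}" "\<tau>' permutes {1..N}" "\<rho> permutes {1..N}"
    and comm: "\<tau> \<circ> \<rho> = \<rho> \<circ> \<tau>'"
    and u: "path u" "path_image u \<subseteq> config N" "pathstart u = base_config N"
    and p: "path p" "path_image p \<subseteq> config N" "pathstart p = pathfinish u"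
      "pathfinish p = pathfinish u \<circ> \<tau>"
    and v: "path v" "path_image v \<subseteq> config N" "pathstart v = base_config N"
      "pathfinish v = pathfinish u \<circ> \<rho>"
  shows "conjugate (abs_braid (N, u +++ p +++ (\<lambda>t. reversepath u t \<circ> \<tau>)))
    (abs_braid (N, v +++ (\<lambda>t. p t \<circ> \<rho>) +++ (\<lambda>t. reversepath v t \<circ> \<tau>')))"
proof -
  define \<rho>i where "\<rho>i = Hilbert_Choice.inv \<rho>"
  have \<rho>i: "\<rho>i permutes {1..N}" "\<rho> \<circ> \<rho>i = id" "\<rho>i \<circ> \<rho> = id"
    using perms(3) by (simp_all add: \<rho>i_def permutes_inv permutes_inv_o)
  have cancel: "\<rho> \<circ> (\<rho>i \<circ> \<tau>) = \<tau>"
    by (simp add: o_assoc \<rho>i(2))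
  have comm': "\<rho>i \<circ> \<tau> = \<tau>' \<circ> \<rho>i"
  proof -
    have "\<rho>i \<circ> \<tau> = \<rho>i \<circ> (\<tau> \<circ> \<rho>) \<circ> \<rho>i"
      using \<rho>i(2) by (simp add: o_assoc[symmetric])
    also have "\<dots> = (\<rho>i \<circ> \<rho>) \<circ> \<tau>' \<circ> \<rho>i"
      unfolding comm by (simp add: o_assoc)
    finally show ?thesis
      using \<rho>i(3) by simp
  qed
  let ?ut = "\<lambda>t. u t \<circ> \<tau>" and ?vi = "\<lambda>t. v t \<circ> \<rho>i"
  let ?a = "u +++ reversepath ?vi"
  let ?c = "u +++ p +++ reversepath ?ut"
  let ?c' = "v +++ (\<lambda>t. p t \<circ> \<rho>) +++ reversepath (\<lambda>t. v t \<circ> \<tau>')"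
  let ?w = "reversepath (\<lambda>t. v t \<circ> \<rho>i \<circ> \<tau>)"
  note rel = path_relabel path_image_relabel[OF _ perms(1)] path_image_relabel[OF _ perms(2)]
    path_image_relabel[OF _ perms(3)] path_image_relabel[OF _ \<rho>i(1)]
  have ut: "path ?ut" "path_image ?ut \<subseteq> config N" and vi: "path ?vi" "path_image ?vi \<subseteq> config N"
    and p\<rho>: "path (\<lambda>t. p t \<circ> \<rho>)" "path_image (\<lambda>t. p t \<circ> \<rho>) \<subseteq> config N"
    and vt: "path (\<lambda>t. v t \<circ> \<tau>')" "path_image (\<lambda>t. v t \<circ> \<tau>') \<subseteq> config N"
    using u p v rel by auto
  have w: "path ?w" "path_image ?w \<subseteq> config N"
    using rel(1)[OF vi(1), of \<tau>] rel(2)[OF vi(2)] by auto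
  have ends: "pathstart ?ut = base_config N \<circ> \<tau>" "pathfinish ?ut = pathfinish u \<circ> \<tau>"
    "pathstart ?vi = base_config N \<circ> \<rho>i" "pathfinish ?vi = pathfinish u"
    "pathstart (\<lambda>t. v t \<circ> \<tau>') = base_config N \<circ> \<tau>'" 
    "pathfinish (\<lambda>t. v t \<circ> \<tau>') = pathfinish u \<circ> \<rho> \<circ> \<tau>'"
    "pathstart (\<lambda>t. p t \<circ> \<rho>) = pathfinish u \<circ> \<rho>"
    "pathfinish (\<lambda>t. p t \<circ> \<rho>) = pathfinish u \<circ> \<rho> \<circ> \<tau>'"
    "pathstart ?w = pathfinish u \<circ> \<tau>" "pathfinish ?w = base_config N \<circ> (\<rho>i \<circ> \<tau>)"
    using u p v \<rho>i(2,3) comm cancel by (simp_all add: relabel_ends o_assoc[symmetric])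
  have a: "geometric_braid N ?a" "end_perm N ?a = \<rho>i"
    using N u vi ends \<rho>i(1)
    by (intro geometric_braidI; simp add: subset_path_image_join)+
  have c: "geometric_braid N ?c" "end_perm N ?c = \<tau>"
    using N u p ut ends perms
    by (intro geometric_braidI; simp add: subset_path_image_join)+
  have c': "geometric_braid N ?c'" "end_perm N ?c' = \<tau>'"
    using N v p\<rho> vt ends perms
    by (intro geometric_braidI; simp add: subset_path_image_join)+
  note stacks = geometric_braid_stack(1)[OF c(1) a(1)] geometric_braid_stack(1)[OF a(1) c'(1)]
  \<comment> \<open>With \<open>a = u v\<inverse>\<close>, both \<open>c a\<close> and \<open>a c'\<close> contract to \<open>u\<close>, then \<open>p\<close>, then \<open>v\<inverse>\<close>.\<close>
  have e1: "stack N ?c ?a = (u +++ p +++ reversepath ?ut) +++ (?ut +++ ?w)"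
    by (simp add: stack_def c relabel_join relabel_reversepath)
  have h1: "homotopic_paths (config N) ((u +++ p +++ reversepath ?ut) +++ (?ut +++ ?w)) (u +++ (p +++ reversepath ?ut) +++ (?ut +++ ?w))"
    using u p ut w ends
    by (intro homotopic_paths_sym[OF homotopic_paths_assoc]) (auto simp: subset_path_image_join)
  have h2: "homotopic_paths (config N) (u +++ (p +++ reversepath ?ut) +++ (?ut +++ ?w)) (u +++ p +++ reversepath ?ut +++ ?ut +++ ?w)"
    using u p ut w ends
    by (intro homotopic_paths_join homotopic_paths_sym[OF homotopic_paths_assoc])
      (auto simp: subset_path_image_join)
  have h3: "homotopic_paths (config N) (u +++ p +++ reversepath ?ut +++ ?ut +++ ?w) (u +++ p +++ ?w)"
    using u p ut w ends
    by (intro homotopic_paths_join homotopic_join_cancel) (auto simp: subset_path_image_join)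
  have 1: "homotopic_paths (config N) (stack N ?c ?a) (u +++ p +++ ?w)"
    unfolding e1 by (rule homotopic_paths_trans[OF h1 homotopic_paths_trans[OF h2 h3]])
  have "(\<lambda>t. p t \<circ> \<rho> \<circ> \<rho>i) = p"
    using \<rho>i(2) by (simp add: o_assoc[symmetric])
  moreover have "(\<lambda>t. v t \<circ> \<tau>' \<circ> \<rho>i) = (\<lambda>t. v t \<circ> \<rho>i \<circ> \<tau>)"
    using comm' by (simp add: o_assoc[symmetric])
  ultimately have e2: "stack N ?a ?c' = (u +++ reversepath ?vi) +++ (?vi +++ p +++ ?w)"
    by (simp add: stack_def a relabel_join relabel_reversepath)
  have g1: "homotopic_paths (config N) ((u +++ reversepath ?vi) +++ (?vi +++ p +++ ?w)) (u +++ reversepath ?vi +++ (?vi +++ p +++ ?w))"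
    using u p vi w ends
    by (intro homotopic_paths_sym[OF homotopic_paths_assoc]) (auto simp: subset_path_image_join)
  have g2: "homotopic_paths (config N) (u +++ reversepath ?vi +++ (?vi +++ p +++ ?w)) (u +++ p +++ ?w)"
    using u p vi w ends
    by (intro homotopic_paths_join homotopic_join_cancel) (auto simp: subset_path_image_join)
  have 2: "homotopic_paths (config N) (stack N ?a ?c') (u +++ p +++ ?w)"
    unfolding e2 by (rule homotopic_paths_trans[OF g1 g2])
  have "abs_braid (N, stack N ?c ?a) = abs_braid (N, stack N ?a ?c')"
    using abs_braid_eqI[OF stacks homotopic_paths_trans[OF 1 homotopic_paths_sym[OF 2]]] .
  then have "conjugate (abs_braid (N, ?c)) (abs_braid (N, ?c'))"
    using a c c' N
    by (intro conjugateI[of "abs_braid (N, ?a)" N]) (simp_all add: strands_abs braid_mult_abs)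
  then show ?thesis by (simp add: relabel_reversepath)
qed


section \<open>Numbering the strands of a cable\<close>

text \<open>
  The strands of a cable have two descriptions: the number \<open>p\<close> counted from the left, and the site
  \<open>(j, m)\<close>, the \<open>m\<close>-th copy of strand \<open>j\<close>. The sites make it visible how permutations of the
  strands of the core and of the inserted braids act on the cable.
\<close>

definition cable_sites :: "nat \<Rightarrow> (nat \<Rightarrow> nat) \<Rightarrow> (nat \<times> nat) set" where
  "cable_sites n k = Sigma {1..n} (\<lambda>j. {1..k j})"

definition site_index :: "(nat \<Rightarrow> nat) \<Rightarrow> nat \<times> nat \<Rightarrow> nat" where
  "site_index k s = cable_offset k (fst s) + snd s"

definition index_site :: "(nat \<Rightarrow> nat) \<Rightarrow> nat \<Rightarrow> nat \<times> nat" where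
  "index_site k p = (cable_block k p, p - cable_offset k (cable_block k p))"

lemma sum_upto_eq_offset: "1 \<le> j \<Longrightarrow> (\<Sum>i\<in>{1..j}. k i) = cable_offset k j + k j"
  unfolding cable_offset_def by (cases j) (auto simp: atLeastLessThanSuc_atLeastAtMost)

lemma cable_offset_mono:
  assumes "1 \<le> i" "i < j"
  shows "cable_offset k i + k i \<le> cable_offset k j"
proof -
  have "(\<Sum>i\<in>{1..i}. k i) \<le> cable_offset k j"
    unfolding cable_offset_def using assms by (intro sum_mono2) auto
  then show ?thesis using sum_upto_eq_offset[OF assms(1), of k] by simp
qed

lemma cable_block_index:
  assumes "(j, m) \<in> cable_sites n k"
  shows "cable_block k (cable_offset k j + m) = j"
  unfolding cable_block_def
proof (rule Least_equality)
  show "cable_offset k j + m \<le> (\<Sum>i\<in>{1..j}. k i)"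
    using assms sum_upto_eq_offset[of j k] by (auto simp: cable_sites_def)
  fix i assume i: "cable_offset k j + m \<le> (\<Sum>i\<in>{1..i}. k i)"
  show "j \<le> i"
  proof (rule ccontr)
    assume "\<not> j \<le> i"
    then have "(\<Sum>i\<in>{1..i}. k i) \<le> cable_offset k j"
      unfolding cable_offset_def by (intro sum_mono2) auto
    then show False using i assms by (auto simp: cable_sites_def)
  qed
qed

lemma index_site_inverse: "s \<in> cable_sites n k \<Longrightarrow> index_site k (site_index k s) = s"
  by (cases s) (simp add: index_site_def site_index_def cable_block_index)

lemma index_site_properties:
  assumes "p \<in> {1..(\<Sum>i\<in>{1..n}. k i)}"
  shows "index_site k p \<in> cable_sites n k" "site_index k (index_site k p) = p"
proof -
  let ?j = "cable_block k p"
  have le: "p \<le> (\<Sum>i\<in>{1..?j}. k i)" and jn: "?j \<le> n"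
    unfolding cable_block_def using assms by (auto intro: LeastI Least_le)
  have j1: "1 \<le> ?j"
    using le assms by (cases ?j) auto
  have "\<not> p \<le> (\<Sum>i\<in>{1..?j - 1}. k i)"
    using j1 not_less_Least[of "?j - 1" "\<lambda>j. p \<le> (\<Sum>i\<in>{1..j}. k i)"]
    unfolding cable_block_def by force
  moreover have "{1..?j - 1} = {1..<?j}" using j1 by auto
  ultimately have "cable_offset k ?j < p"
    unfolding cable_offset_def by simp
  then show "index_site k p \<in> cable_sites n k" "site_index k (index_site k p) = p"
    using le jn j1 sum_upto_eq_offset[OF j1, of k]
    by (auto simp: index_site_def site_index_def cable_sites_def)
qed

lemma site_index_range:
  assumes "s \<in> cable_sites n k"
  shows "site_index k s \<in> {1..(\<Sum>i\<in>{1..n}. k i)}"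
proof -
  obtain j m where s: "s = (j, m)" "1 \<le> j" "j \<le> n" "1 \<le> m" "m \<le> k j"
    using assms by (auto simp: cable_sites_def)
  have "(\<Sum>i\<in>{1..j}. k i) \<le> (\<Sum>i\<in>{1..n}. k i)"
    using s by (intro sum_mono2) auto
  then show ?thesis
    using s sum_upto_eq_offset[OF s(2), of k] by (simp add: site_index_def)
qed

lemma bij_betw_index_site:
  "bij_betw (index_site k) {1..(\<Sum>i\<in>{1..n}. k i)} (cable_sites n k)"
  by (rule bij_betw_byWitness[where f' = "site_index k"])
    (use index_site_inverse index_site_properties site_index_range in blast)+

lemma bij_betw_site_index:
  "bij_betw (site_index k) (cable_sites n k) {1..(\<Sum>i\<in>{1..n}. k i)}"
  by (rule bij_betw_byWitness[where f' = "index_site k"])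
    (use index_site_inverse index_site_properties site_index_range in blast)+

text \<open>
  One horizontal section of a cable. Separating it from the time parameter makes the dependence on
  \<open>\<epsilon>\<close> and on the parameters of a homotopy accessible to continuity arguments.
\<close>

definition cable_point ::
  "nat \<Rightarrow> (nat \<Rightarrow> nat) \<Rightarrow> real \<Rightarrow> (nat \<Rightarrow> nat \<Rightarrow> complex) \<Rightarrow> (nat \<Rightarrow> complex) \<Rightarrow> nat \<Rightarrow> complex" where
  "cable_point n k \<epsilon> D x = (\<lambda>p.
     if p \<in> {1..(\<Sum>i\<in>{1..n}. k i)} then
       (case index_site k p of (j, m) \<Rightarrow> x j + \<epsilon> *\<^sub>R D j m)
     else 0)"

lemma cable_path_eq_point: "cable_path n k \<epsilon> \<delta> \<gamma> = (\<lambda>t. cable_point n k \<epsilon> (\<lambda>j. \<delta> j t) (\<gamma> t))"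
  by (simp add: cable_path_def cable_point_def index_site_def Let_def fun_eq_iff)

lemma cable_point_cong:
  assumes "\<And>j. j \<in> {1..n} \<Longrightarrow> D j = D' j" "\<And>j. j \<in> {1..n} \<Longrightarrow> x j = x' j"
  shows "cable_point n k \<epsilon> D x = cable_point n k \<epsilon> D' x'"
proof
  fix p
  show "cable_point n k \<epsilon> D x p = cable_point n k \<epsilon> D' x' p"
    using index_site_properties(1)[of p k n] assms
    by (auto simp: cable_point_def cable_sites_def split: prod.splits)
qed

lemma cable_path_join:
  "cable_path n k \<epsilon> (\<lambda>j. \<delta> j +++ \<delta>' j) (\<gamma> +++ \<gamma>') = cable_path n k \<epsilon> \<delta> \<gamma> +++ cable_path n k \<epsilon> \<delta>' \<gamma>'"
  by (simp add: cable_path_eq_point joinpaths_def fun_eq_iff)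

text \<open>
  A bijection between the sites of two cables becomes a renumbering \<open>\<rho>\<close> of the strands. It depends
  on the bijection only, so one \<open>\<rho>\<close> serves all heights and all \<open>\<epsilon>\<close>; this is what makes it a
  relabelling of paths.
\<close>

lemma cable_point_relabel:
  assumes "bij_betw \<phi> (cable_sites n k') (cable_sites n k)"
  obtains \<rho> where "\<rho> permutes {1..(\<Sum>i\<in>{1..n}. k' i)}"
    and "\<And>\<epsilon> D x D' x'. (\<And>j m. (j, m) \<in> cable_sites n k' \<Longrightarrow>
          x' j = x (fst (\<phi> (j, m))) \<and> D' j m = D (fst (\<phi> (j, m))) (snd (\<phi> (j, m)))) \<Longrightarrow>
        cable_point n k' \<epsilon> D' x' = cable_point n k \<epsilon> D x \<circ> \<rho>"
proof -
  let ?N = "\<Sum>i\<in>{1..n}. k i" and ?N' = "\<Sum>i\<in>{1..n}. k' i"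
  define \<rho> where "\<rho> = (\<lambda>p. if p \<in> {1..?N'} then site_index k (\<phi> (index_site k' p)) else p)"
  have bij: "bij_betw (site_index k \<circ> (\<phi> \<circ> index_site k')) {1..?N'} {1..?N}"
    by (intro bij_betw_trans[OF _ bij_betw_site_index] bij_betw_trans[OF bij_betw_index_site assms])
  then have N: "?N' = ?N"
    using bij_betw_same_card by fastforce
  have "bij_betw \<rho> {1..?N'} {1..?N'}"
    using bij unfolding N \<rho>_def by (rule bij_betw_cong[THEN iffD1, rotated]) simp
  then have "\<rho> permutes {1..?N'}"
    by (rule bij_imp_permutes) (auto simp: \<rho>_def)
  moreover have "cable_point n k' \<epsilon> D' x' = cable_point n k \<epsilon> D x \<circ> \<rho>"
    if eq: "\<And>j m. (j, m) \<in> cable_sites n k' \<Longrightarrow>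
          x' j = x (fst (\<phi> (j, m))) \<and> D' j m = D (fst (\<phi> (j, m))) (snd (\<phi> (j, m)))"
    for \<epsilon> D x D' x'
  proof
    fix p
    show "cable_point n k' \<epsilon> D' x' p = (cable_point n k \<epsilon> D x \<circ> \<rho>) p"
    proof (cases "p \<in> {1..?N'}")
      case True
      define s where "s = index_site k' p"
      have s: "s \<in> cable_sites n k'"
        using index_site_properties(1)[OF True] by (simp add: s_def)
      then have \<phi>: "\<phi> s \<in> cable_sites n k"
        using assms by (auto simp: bij_betw_def)
      have "\<rho> p = site_index k (\<phi> s)"
        using True by (simp add: \<rho>_def s_def)
      then have "index_site k (\<rho> p) = \<phi> s" "\<rho> p \<in> {1..?N}"
        using index_site_inverse[OF \<phi>] site_index_range[OF \<phi>] by auto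
      moreover have "index_site k' p = s" by (simp add: s_def)
      ultimately show ?thesis
        using True eq[of "fst s" "snd s"] s by (simp add: cable_point_def case_prod_unfold)
    next
      case False
      then show ?thesis unfolding cable_point_def \<rho>_def N by auto
    qed
  qed
  ultimately show ?thesis using that by blast
qed

lemma cable_point_inner_relabel:
  assumes "\<And>j. j \<in> {1..n} \<Longrightarrow> \<sigma> j permutes {1..k j}"
  obtains \<tau> where "\<tau> permutes {1..(\<Sum>i\<in>{1..n}. k i)}"
    and "\<And>\<epsilon> D x. cable_point n k \<epsilon> (\<lambda>j. D j \<circ> \<sigma> j) x = cable_point n k \<epsilon> D x \<circ> \<tau>"
proof -
  let ?\<phi> = "\<lambda>(j, m). (j, \<sigma> j m)"
  have inv: "Hilbert_Choice.inv (\<sigma> j) (\<sigma> j m) = m" "\<sigma> j (Hilbert_Choice.inv (\<sigma> j) m) = m"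
    if "j \<in> {1..n}" for j m
    using permutes_inverses[OF assms[OF that]] by auto
  have "bij_betw ?\<phi> (cable_sites n k) (cable_sites n k)"
    by (rule bij_betw_byWitness[where f' = "\<lambda>(j, m). (j, Hilbert_Choice.inv (\<sigma> j) m)"])
      (use assms permutes_inv[OF assms] in
        \<open>auto simp: cable_sites_def inv permutes_in_image simp flip: atLeastAtMost_iff\<close>)
  then show ?thesis
  proof (rule cable_point_relabel)
    fix \<tau>
    assume \<tau>: "\<tau> permutes {1..(\<Sum>i\<in>{1..n}. k i)}"
      and eq: "\<And>\<epsilon> D x D' x'. (\<And>j m. (j, m) \<in> cable_sites n k \<Longrightarrow>
          x' j = x (fst (?\<phi> (j, m))) \<and> D' j m = D (fst (?\<phi> (j, m))) (snd (?\<phi> (j, m)))) \<Longrightarrow>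
        cable_point n k \<epsilon> D' x' = cable_point n k \<epsilon> D x \<circ> \<tau>"
    show ?thesis
      by (rule that[OF \<tau>], rule eq) simp
  qed
qed

lemma cable_point_outer_relabel:
  assumes "\<sigma> permutes {1..n}"
  obtains \<rho> where "\<rho> permutes {1..(\<Sum>i\<in>{1..n}. k i)}"
    and "\<And>\<epsilon> D x. cable_point n k \<epsilon> D (x \<circ> Hilbert_Choice.inv \<sigma>)
          = cable_point n (k \<circ> \<sigma>) \<epsilon> (D \<circ> \<sigma>) x \<circ> \<rho>"
proof -
  let ?\<phi> = "\<lambda>(j, m). (Hilbert_Choice.inv \<sigma> j, m)"
  note inv = permutes_inv[OF assms] permutes_inverses[OF assms]
  have "bij_betw ?\<phi> (cable_sites n k) (cable_sites n (k \<circ> \<sigma>))"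
    by (rule bij_betw_byWitness[where f' = "\<lambda>(j, m :: nat). (\<sigma> j, m)"])
      (use inv(2,3) permutes_in_image[OF assms] permutes_in_image[OF inv(1)] in
        \<open>auto simp: cable_sites_def simp flip: atLeastAtMost_iff\<close>)
  then show ?thesis
  proof (rule cable_point_relabel)
    fix \<rho>
    assume \<rho>: "\<rho> permutes {1..(\<Sum>i\<in>{1..n}. k i)}"
      and eq: "\<And>\<epsilon> D x D' x'. (\<And>j m. (j, m) \<in> cable_sites n k \<Longrightarrow>
          x' j = x (fst (?\<phi> (j, m))) \<and> D' j m = D (fst (?\<phi> (j, m))) (snd (?\<phi> (j, m)))) \<Longrightarrow>
        cable_point n k \<epsilon> D' x' = cable_point n (k \<circ> \<sigma>) \<epsilon> D x \<circ> \<rho>"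
    show ?thesis
      by (rule that[OF \<rho>], rule eq) (simp add: inv)
  qed
qed


section \<open>Thin cables\<close>

text \<open>
  On a compact set \<open>norm f\<close> is bounded away from 0 and \<open>norm h\<close> is bounded, so one \<open>\<epsilon>\<close> works for all
  points.
\<close>

lemma eventually_perturbation_nonzero:
  fixes f h :: "'z::topological_space \<Rightarrow> 'v::real_normed_vector"
  assumes "compact K" "continuous_on K f" "continuous_on K h" "\<And>z. z \<in> K \<Longrightarrow> f z \<noteq> 0"
  shows "\<forall>\<^sub>F \<epsilon> in at_right 0. \<forall>z\<in>K. f z + \<epsilon> *\<^sub>R h z \<noteq> 0"
proof (cases "K = {}")
  case False
  obtain a where a: "a \<in> K" "\<And>z. z \<in> K \<Longrightarrow> norm (f a) \<le> norm (f z)"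
    using continuous_attains_inf[OF assms(1) False continuous_on_norm[OF assms(2)]] by auto
  obtain c where c: "c \<in> K" "\<And>z. z \<in> K \<Longrightarrow> norm (h z) \<le> norm (h c)"
    using continuous_attains_sup[OF assms(1) False continuous_on_norm[OF assms(3)]] by auto
  have "norm (f a) > 0" using a assms(4) by auto
  then have "0 < norm (f a) / (norm (h c) + 1)" by (simp add: add_nonneg_pos)
  then have "\<forall>\<^sub>F \<epsilon> in at_right 0. \<epsilon> \<in> {0<..<norm (f a) / (norm (h c) + 1)}"
    by (rule eventually_at_right_real)
  then show ?thesis
  proof eventually_elim
    case (elim \<epsilon>)
    then have e: "0 < \<epsilon>" "\<epsilon> * (norm (h c) + 1) < norm (f a)"
      by (auto simp: pos_less_divide_eq add_nonneg_pos)
    show ?case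
    proof
      fix z assume z: "z \<in> K"
      have "norm (\<epsilon> *\<^sub>R h z) \<le> \<epsilon> * (norm (h c) + 1)"
        using e c(2)[OF z] by (simp add: mult_left_mono)
      also have "\<dots> < norm (f z)" using e a(2)[OF z] by simp
      finally show "f z + \<epsilon> *\<^sub>R h z \<noteq> 0"
        by (metis add_eq_0_iff norm_minus_cancel order_less_irrefl)
    qed
  qed
qed simp

text \<open>
  Copies of the same strand stay apart for every \<open>\<epsilon> > 0\<close>, since the inserted configuration has
  distinct points. Copies of different strands \<open>i \<noteq> j\<close> are at a difference that is a small
  perturbation of the nonzero difference of the strands. The compact parameter space \<open>K\<close> is the
  time interval for a single cable and a square for a homotopy of cables.
\<close>

lemma eventually_cable_in_config:
  fixes K :: "'z::topological_space set"
  assumes K: "compact K" and G: "continuous_on K G" "G ` K \<subseteq> config n"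
    and D: "\<And>j. j \<in> {1..n} \<Longrightarrow> continuous_on K (D j)" "\<And>j. j \<in> {1..n} \<Longrightarrow> D j ` K \<subseteq> config (k j)"
  shows "\<forall>\<^sub>F \<epsilon> in at_right 0. \<forall>z\<in>K.
    cable_point n k \<epsilon> (\<lambda>j. D j z) (G z) \<in> config (\<Sum>i\<in>{1..n}. k i)"
proof -
  let ?N = "\<Sum>i\<in>{1..n}. k i"
  let ?C = "\<lambda>\<epsilon> z. cable_point n k \<epsilon> (\<lambda>j. D j z) (G z)"
  have pair: "\<forall>\<^sub>F \<epsilon> in at_right 0. p \<noteq> q \<longrightarrow> (\<forall>z\<in>K. ?C \<epsilon> z p \<noteq> ?C \<epsilon> z q)"
    if p: "p \<in> {1..?N}" and q: "q \<in> {1..?N}" for p q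
  proof (cases "p = q")
    case ne: False
    obtain i l j m where il: "index_site k p = (i, l)" and jm: "index_site k q = (j, m)"
      by fastforce
    have site: "i \<in> {1..n}" "l \<in> {1..k i}" "j \<in> {1..n}" "m \<in> {1..k j}" "(i, l) \<noteq> (j, m)"
      using index_site_properties[OF p] index_site_properties[OF q] ne
      by (auto simp: il jm cable_sites_def)
    have C: "?C \<epsilon> z p = G z i + \<epsilon> *\<^sub>R D i z l" "?C \<epsilon> z q = G z j + \<epsilon> *\<^sub>R D j z m" for \<epsilon> z
      using p q by (simp_all add: cable_point_def il jm)
    show ?thesis
    proof (cases "i = j")
      case True
      have "D i z l \<noteq> D i z m" if "z \<in> K" for z
        using D(2)[OF site(1)] that site True unfolding config_def inj_on_def by blast
      moreover have "\<forall>\<^sub>F \<epsilon> in at_right (0::real). \<epsilon> > 0"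
        by (rule eventually_at_right_less)
      ultimately show ?thesis
        unfolding C using True by (auto elim: eventually_mono)
    next
      case False
      have "\<forall>\<^sub>F \<epsilon> in at_right 0. \<forall>z\<in>K. (G z i - G z j) + \<epsilon> *\<^sub>R (D i z l - D j z m) \<noteq> 0"
      proof (rule eventually_perturbation_nonzero[OF K])
        show "continuous_on K (\<lambda>z. G z i - G z j)"
          by (intro continuous_on_diff continuous_on_product_then_coordinatewise[OF G(1)])
        show "continuous_on K (\<lambda>z. D i z l - D j z m)"
          using continuous_on_product_then_coordinatewise[OF D(1)[OF site(1)]]
            continuous_on_product_then_coordinatewise[OF D(1)[OF site(3)]]
          by (rule continuous_on_diff)
        show "G z i - G z j \<noteq> 0" if "z \<in> K" for z
        proof -
          have "inj_on (G z) {1..n}"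
            using G(2) that by (auto simp: config_def)
          then show ?thesis using site False by (auto dest: inj_onD)
        qed
      qed
      then show ?thesis
        unfolding C by (rule eventually_mono) (auto simp: algebra_simps)
    qed
  qed simp
  have "\<forall>\<^sub>F \<epsilon> in at_right 0. \<forall>p\<in>{1..?N}. \<forall>q\<in>{1..?N}. p \<noteq> q \<longrightarrow> (\<forall>z\<in>K. ?C \<epsilon> z p \<noteq> ?C \<epsilon> z q)"
    using pair by (intro eventually_ball_finite finite_atLeastAtMost ballI)
  then show ?thesis
  proof (rule eventually_mono, intro ballI)
    fix \<epsilon> z
    assume *: "\<forall>p\<in>{1..?N}. \<forall>q\<in>{1..?N}. p \<noteq> q \<longrightarrow> (\<forall>z\<in>K. ?C \<epsilon> z p \<noteq> ?C \<epsilon> z q)" and z: "z \<in> K"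
    have "inj_on (?C \<epsilon> z) {1..?N}"
      using * z unfolding inj_on_def by blast
    moreover have "?C \<epsilon> z p = 0" if "p \<notin> {1..?N}" for p
      unfolding cable_point_def using that by argo
    ultimately show "?C \<epsilon> z \<in> config ?N"
      unfolding config_def by blast
  qed
qed

text \<open>
  The real parts increase with the label; the zero values outside \<open>{1..N}\<close> are the convention for
  configurations.
\<close>

definition left_to_right :: "nat \<Rightarrow> (nat \<Rightarrow> complex) \<Rightarrow> bool" where
  "left_to_right N x \<longleftrightarrow>
     (\<forall>p\<in>{1..N}. \<forall>q\<in>{1..N}. p < q \<longrightarrow> Re (x p) < Re (x q)) \<and> (\<forall>p. p \<notin> {1..N} \<longrightarrow> x p = 0)"

definition cable_base :: "nat \<Rightarrow> (nat \<Rightarrow> nat) \<Rightarrow> real \<Rightarrow> nat \<Rightarrow> complex" where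
  "cable_base n k \<epsilon> = cable_point n k \<epsilon> (\<lambda>j. base_config (k j)) (base_config n)"

text \<open>
  The copies of strand \<open>i\<close> sit at \<open>i + \<epsilon> l\<close> with \<open>l \<le> N\<close>; for \<open>\<epsilon> N < 1\<close> the cable of one
  strand therefore ends before the next integer, where the following strand starts.
\<close>

lemma eventually_cable_base_left_to_right:
  "\<forall>\<^sub>F \<epsilon> in at_right 0. left_to_right (\<Sum>i\<in>{1..n}. k i) (cable_base n k \<epsilon>)"
proof -
  define N where "N = (\<Sum>i\<in>{1..n}. k i)"
  have "\<forall>\<^sub>F \<epsilon> in at_right (0::real). \<epsilon> \<in> {0<..<1 / (real N + 1)}"
    by (rule eventually_at_right_real) simp
  then show ?thesis
  unfolding N_def[symmetric]
  proof (rule eventually_mono)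
    fix \<epsilon> assume "\<epsilon> \<in> {0<..<1 / (real N + 1)}"
    then have \<epsilon>: "0 < \<epsilon>" "\<epsilon> * (real N + 1) < 1"
      by (auto simp: pos_less_divide_eq)
    have "Re (cable_base n k \<epsilon> p) < Re (cable_base n k \<epsilon> q)"
      if p: "p \<in> {1..N}" and q: "q \<in> {1..N}" and "p < q" for p q
    proof -
      obtain i l j m where il: "index_site k p = (i, l)" and jm: "index_site k q = (j, m)"
        by fastforce
      have site: "i \<in> {1..n}" "l \<in> {1..k i}" "j \<in> {1..n}" "m \<in> {1..k j}"
        and pq: "p = cable_offset k i + l" "q = cable_offset k j + m"
        using index_site_properties[OF p[unfolded N_def]] index_site_properties[OF q[unfolded N_def]]
        by (auto simp: il jm cable_sites_def site_index_def)
      have x: "Re (cable_base n k \<epsilon> p) = real i + \<epsilon> * real l"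
        "Re (cable_base n k \<epsilon> q) = real j + \<epsilon> * real m"
        using p q site by (simp_all add: N_def cable_base_def cable_point_def il jm base_config_def)
      have "i \<le> j"
        using cable_offset_mono[of j i k] site pq \<open>p < q\<close> by (cases "j < i") auto
      then consider "i = j" | "i < j" by linarith
      then show ?thesis
      proof cases
        case 1
        then show ?thesis using \<epsilon> pq \<open>p < q\<close> unfolding x by simp
      next
        case 2
        have "l \<le> N" using p pq by simp
        then have "\<epsilon> * real l \<le> \<epsilon> * (real N + 1)"
          using \<epsilon>(1) by (intro mult_left_mono) linarith+
        then have "real i + \<epsilon> * real l < real i + 1" using \<epsilon> by linarith
        also have "\<dots> \<le> real j + \<epsilon> * real m" using 2 \<epsilon>(1) by (simp add: add_increasing2)
        finally show ?thesis unfolding x .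
      qed
    qed
    moreover have "cable_base n k \<epsilon> p = 0" if "p \<notin> {1..N}" for p
      unfolding cable_base_def cable_point_def using that[unfolded N_def] by argo
    ultimately show "left_to_right N (cable_base n k \<epsilon>)"
      unfolding left_to_right_def by blast
  qed
qed

lemma rank_config_left_to_right:
  assumes "left_to_right N x"
  shows "rank_config N x = base_config N"
proof
  fix p
  show "rank_config N x p = base_config N p"
  proof (cases "p \<in> {1..N}")
    case True
    have "{q \<in> {1..N}. Re (x q) \<le> Re (x p)} = {1..p}"
    proof (intro equalityI subsetI)
      fix q assume q: "q \<in> {q \<in> {1..N}. Re (x q) \<le> Re (x p)}"
      then have "\<not> p < q"
        using assms True unfolding left_to_right_def by force
      then show "q \<in> {1..p}" using q by auto
    next
      fix q assume q: "q \<in> {1..p}"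
      then have "q = p \<or> Re (x q) < Re (x p)"
        using assms True unfolding left_to_right_def by (cases "q < p") auto
      then show "q \<in> {q \<in> {1..N}. Re (x q) \<le> Re (x p)}" using q True by auto
    qed
    then show ?thesis
      using True by (simp add: rank_config_def base_config_def)
  qed (auto simp: rank_config_def base_config_def)
qed

lemma rank_config_permute:
  assumes "\<tau> permutes {1..N}"
  shows "rank_config N (x \<circ> \<tau>) = rank_config N x \<circ> \<tau>"
proof
  fix p
  have "\<tau> ` {q \<in> {1..N}. Re (x (\<tau> q)) \<le> Re (x (\<tau> p))} = {q \<in> {1..N}. Re (x q) \<le> Re (x (\<tau> p))}"
    (is "_ ` ?A = ?B")
  proof (intro equalityI subsetI)
    fix q assume "q \<in> ?B"
    then have "Hilbert_Choice.inv \<tau> q \<in> ?A" "q = \<tau> (Hilbert_Choice.inv \<tau> q)"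
      using permutes_inverses[OF assms] permutes_in_image[OF permutes_inv[OF assms]] by auto
    then show "q \<in> \<tau> ` ?A" by blast
  qed (use permutes_in_image[OF assms] in auto)
  then have "card ?A = card ?B"
    using card_image[OF permutes_inj_on[OF assms], of ?A] by simp
  then show "rank_config N (x \<circ> \<tau>) p = (rank_config N x \<circ> \<tau>) p"
    using permutes_in_image[OF assms, of p] by (simp add: rank_config_def)
qed

text \<open>
  On both ends the points are ordered by their labels, and so is every convex combination; hence no
  two points collide.
\<close>

lemma slide_base:
  assumes "left_to_right N x"
  shows "path (slide (base_config N) x)" "path_image (slide (base_config N) x) \<subseteq> config N"
    "pathstart (slide (base_config N) x) = base_config N" "pathfinish (slide (base_config N) x) = x"
proof -
  show "path (slide (base_config N) x)"
    unfolding path_def slide_def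
    by (intro continuous_on_coordinatewise_then_product continuous_intros)
  show "path_image (slide (base_config N) x) \<subseteq> config N"
  proof -
    have "slide (base_config N) x t \<in> config N" if t: "t \<in> {0..1}" for t
    proof -
      have less: "Re (slide (base_config N) x t p) < Re (slide (base_config N) x t q)"
        if pq: "p \<in> {1..N}" "q \<in> {1..N}" "p < q" for p q
      proof -
        have x: "Re (x p) < Re (x q)"
          using assms pq unfolding left_to_right_def by blast
        show ?thesis
        proof (cases "t = 0")
          case True
          then show ?thesis using pq by (simp add: slide_def linepath_def base_config_def)
        next
          case False
          then have "t * Re (x p) < t * Re (x q)" "(1 - t) * real p \<le> (1 - t) * real q"
            using t x pq by (auto intro!: mult_left_mono mult_strict_left_mono)
          then show ?thesis
            using pq by (simp add: slide_def linepath_def base_config_def)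
        qed
      qed
      have "inj_on (slide (base_config N) x t) {1..N}"
      proof (rule inj_onI)
        fix p q assume "p \<in> {1..N}" "q \<in> {1..N}"
          and "slide (base_config N) x t p = slide (base_config N) x t q"
        then show "p = q"
          using less[of p q] less[of q p] by (cases p q rule: linorder_cases) auto
      qed
      then show ?thesis
        using assms by (auto simp: config_def left_to_right_def slide_def base_config_def linepath_def)
    qed
    then show ?thesis by (auto simp: path_image_def)
  qed
qed (simp_all add: pathstart_def pathfinish_def slide_def linepath_def)

text \<open>
  A path from \<open>x\<close> to \<open>x \<circ> \<tau>\<close> is standardized by one and the same slide at both ends, reversed and
  relabelled at the bottom. This is the form in which \<open>conjugate_transport\<close> produces braids.
\<close>

lemma standardize_eq:
  assumes "left_to_right N x" "\<tau> permutes {1..N}" "pathstart P = x" "pathfinish P = x \<circ> \<tau>"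
  shows "standardize N P =
    slide (base_config N) x +++ P +++ (\<lambda>t. reversepath (slide (base_config N) x) t \<circ> \<tau>)"
proof -
  have "slide (x \<circ> \<tau>) (base_config N \<circ> \<tau>) = (\<lambda>t. reversepath (slide (base_config N) x) t \<circ> \<tau>)"
    by (simp add: slide_def reversepath_def linepath_def fun_eq_iff algebra_simps)
  then show ?thesis
    unfolding standardize_def
    using assms by (simp add: rank_config_left_to_right rank_config_permute)
qed


section \<open>Cabling a pure braid is well defined\<close>

text \<open>
  A pure core returns to its start, so a cable of it can only permute the copies of each strand
  among themselves; \<open>\<tau>\<close> is that permutation of the numbered strands.
\<close>

lemma cable_path_ends:
  assumes "geometric_braid n \<gamma>" "pathfinish \<gamma> = base_config n"
    and "\<And>j. j \<in> {1..n} \<Longrightarrow> geometric_braid (k j) (\<delta> j)"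
    and "\<And>\<epsilon> D x. cable_point n k \<epsilon> (\<lambda>j. D j \<circ> end_perm (k j) (\<delta> j)) x = cable_point n k \<epsilon> D x \<circ> \<tau>"
  shows "pathstart (cable_path n k \<epsilon> \<delta> \<gamma>) = cable_base n k \<epsilon>"
    and "pathfinish (cable_path n k \<epsilon> \<delta> \<gamma>) = cable_base n k \<epsilon> \<circ> \<tau>"
proof -
  have \<gamma>: "\<gamma> 0 = base_config n" "\<gamma> 1 = base_config n"
    using assms(1,2) by (auto simp: geometric_braid_def pathstart_def pathfinish_def)
  have \<delta>: "\<delta> j 0 = base_config (k j)" "\<delta> j 1 = base_config (k j) \<circ> end_perm (k j) (\<delta> j)"
    if "j \<in> {1..n}" for j
    using assms(3)[OF that] end_perm(2)[OF assms(3)[OF that]]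
    by (auto simp: geometric_braid_def pathstart_def pathfinish_def)
  show "pathstart (cable_path n k \<epsilon> \<delta> \<gamma>) = cable_base n k \<epsilon>"
    unfolding pathstart_def cable_path_eq_point cable_base_def \<gamma>
    by (rule cable_point_cong) (simp_all add: \<delta>)
  have "pathfinish (cable_path n k \<epsilon> \<delta> \<gamma>)
      = cable_point n k \<epsilon> (\<lambda>j. base_config (k j) \<circ> end_perm (k j) (\<delta> j)) (base_config n)"
    unfolding pathfinish_def cable_path_eq_point cable_base_def \<gamma>
    by (rule cable_point_cong) (simp_all add: \<delta>)
  then show "pathfinish (cable_path n k \<epsilon> \<delta> \<gamma>) = cable_base n k \<epsilon> \<circ> \<tau>"
    unfolding cable_base_def assms(4) .
qed

lemma continuous_on_cable_point:
  assumes "continuous_on K e" "continuous_on K G" "\<And>j. j \<in> {1..n} \<Longrightarrow> continuous_on K (D j)"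
  shows "continuous_on K (\<lambda>z. cable_point n k (e z) (\<lambda>j. D j z) (G z))"
proof (rule continuous_on_coordinatewise_then_product)
  fix p
  show "continuous_on K (\<lambda>z. cable_point n k (e z) (\<lambda>j. D j z) (G z) p)"
  proof (cases "p \<in> {1..(\<Sum>i\<in>{1..n}. k i)}")
    case True
    obtain j m where jm: "index_site k p = (j, m)" by fastforce
    then have j: "j \<in> {1..n}"
      using index_site_properties(1)[OF True] by (simp add: cable_sites_def)
    have "continuous_on K (\<lambda>z. G z j + e z *\<^sub>R D j z m)"
      by (intro continuous_on_add continuous_on_scaleR assms(1)
          continuous_on_product_then_coordinatewise[OF assms(2)]
          continuous_on_product_then_coordinatewise[OF assms(3)[OF j]])
    then show ?thesis
      using True jm by (simp add: cable_point_def)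
  next
    case False
    then have "(\<lambda>z. cable_point n k (e z) (\<lambda>j. D j z) (G z) p) = (\<lambda>z. 0)"
      unfolding cable_point_def by auto
    then show ?thesis by (simp only: continuous_on_const)
  qed
qed

lemma homotopic_pathsE:
  fixes S :: "'a::topological_space set"
  assumes "homotopic_paths S p q"
  obtains h :: "real \<times> real \<Rightarrow> 'a" where "continuous_on ({0..1} \<times> {0..1}) h" "h ` ({0..1} \<times> {0..1}) \<subseteq> S"
    and "\<And>t. t \<in> {0..1} \<Longrightarrow> h (0, t) = p t" "\<And>t. t \<in> {0..1} \<Longrightarrow> h (1, t) = q t"
    and "\<And>s. s \<in> {0..1} \<Longrightarrow> h (s, 0) = pathstart p" "\<And>s. s \<in> {0..1} \<Longrightarrow> h (s, 1) = pathfinish p"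
proof -
  obtain h :: "real \<times> real \<Rightarrow> 'a" where "continuous_on ({0..1} \<times> {0..1}) h \<and> h \<in> ({0..1} \<times> {0..1}) \<rightarrow> S \<and>
      (\<forall>t\<in>{0..1}. h (0, t) = p t) \<and> (\<forall>t\<in>{0..1}. h (1, t) = q t) \<and>
      (\<forall>s\<in>{0..1}. pathstart (h \<circ> Pair s) = pathstart p \<and> pathfinish (h \<circ> Pair s) = pathfinish p)"
    using assms[unfolded homotopic_paths] by (rule exE)
  then show ?thesis
    by (intro that[of h]) (auto simp: pathstart_def pathfinish_def)
qed

text \<open>
  Homotopies of the core and of the inserted braids are cabled slice by slice, while the width moves
  linearly from \<open>\<epsilon>\<close> to \<open>\<epsilon>'\<close>. The ends of the cables move with the width; the slides of
  the standardization follow them, so that the ends of the standardized path stay fixed.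
\<close>

lemma cables_isotopic:
  assumes \<gamma>: "isotopic (n, \<gamma>) (n, \<gamma>')" "pathfinish \<gamma> = base_config n"
    and \<delta>: "\<And>j. j \<in> {1..n} \<Longrightarrow> isotopic (k j, \<delta> j) (k j, \<delta>' j)"
  defines "N \<equiv> \<Sum>i\<in>{1..n}. k i"
  shows "\<exists>e>0. \<forall>\<epsilon> \<epsilon>'. 0 < \<epsilon> \<and> \<epsilon> < e \<and> 0 < \<epsilon>' \<and> \<epsilon>' < e \<longrightarrow>
    isotopic (N, standardize N (cable_path n k \<epsilon> \<delta> \<gamma>)) (N, standardize N (cable_path n k \<epsilon>' \<delta>' \<gamma>'))"
proof -
  let ?I = "{0..1::real} \<times> {0..1::real}"
  have g: "geometric_braid n \<gamma>" "geometric_braid n \<gamma>'" using \<gamma>(1) by auto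
  have d: "geometric_braid (k j) (\<delta> j)" "geometric_braid (k j) (\<delta>' j)"
    "end_perm (k j) (\<delta>' j) = end_perm (k j) (\<delta> j)" if "j \<in> {1..n}" for j
    using \<delta>[OF that] isotopic_end_perm[OF \<delta>[OF that]] by auto
  have \<gamma>': "pathfinish \<gamma>' = base_config n"
    using \<gamma> homotopic_paths_imp_pathfinish by fastforce
  have N1: "1 \<le> N"
  proof -
    have "1 \<le> n" "1 \<le> k 1" using g(1) d(1)[of 1] by (auto simp: geometric_braid_def)
    then show ?thesis
      unfolding N_def using member_le_sum[of 1 "{1..n}" k] by simp
  qed
  obtain \<tau> where \<tau>: "\<tau> permutes {1..N}"
    and cable\<tau>: "\<And>\<epsilon> D x. cable_point n k \<epsilon> (\<lambda>j. D j \<circ> end_perm (k j) (\<delta> j)) x = cable_point n k \<epsilon> D x \<circ> \<tau>"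
    using cable_point_inner_relabel[of n "\<lambda>j. end_perm (k j) (\<delta> j)" k] end_perm(1)[OF d(1)]
    unfolding N_def by blast
  have cable\<tau>': "cable_point n k \<epsilon> (\<lambda>j. D j \<circ> end_perm (k j) (\<delta>' j)) x = cable_point n k \<epsilon> D x \<circ> \<tau>" for \<epsilon> D x
    unfolding cable\<tau>[symmetric] by (rule cable_point_cong) (simp_all add: d(3))
  have ends: "pathstart (cable_path n k \<epsilon> \<delta> \<gamma>) = cable_base n k \<epsilon>"
    "pathfinish (cable_path n k \<epsilon> \<delta> \<gamma>) = cable_base n k \<epsilon> \<circ> \<tau>" for \<epsilon>
    by (rule cable_path_ends[OF g(1) \<gamma>(2) _ cable\<tau>], erule d(1))+
  have ends': "pathstart (cable_path n k \<epsilon> \<delta>' \<gamma>') = cable_base n k \<epsilon>"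
    "pathfinish (cable_path n k \<epsilon> \<delta>' \<gamma>') = cable_base n k \<epsilon> \<circ> \<tau>" for \<epsilon>
    by (rule cable_path_ends[OF g(2) \<gamma>' _ cable\<tau>'], erule d(2))+
  obtain G where G: "continuous_on ?I G" "G ` ?I \<subseteq> config n"
    and G0: "\<And>t. t \<in> {0..1} \<Longrightarrow> G (0, t) = \<gamma> t" and G1: "\<And>t. t \<in> {0..1} \<Longrightarrow> G (1, t) = \<gamma>' t"
    and Gends: "\<And>s. s \<in> {0..1} \<Longrightarrow> G (s, 0) = base_config n" "\<And>s. s \<in> {0..1} \<Longrightarrow> G (s, 1) = base_config n"
  proof (rule homotopic_pathsE)
    show "homotopic_paths (config n) \<gamma> \<gamma>'" using \<gamma>(1) by simp
    have ends: "pathstart \<gamma> = base_config n"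
      using g(1) by (simp add: geometric_braid_def)
    fix h
    assume "continuous_on ?I h" "h ` ?I \<subseteq> config n"
      and "\<And>t. t \<in> {0..1} \<Longrightarrow> h (0, t) = \<gamma> t" "\<And>t. t \<in> {0..1} \<Longrightarrow> h (1, t) = \<gamma>' t"
      and "\<And>s. s \<in> {0..1} \<Longrightarrow> h (s, 0) = pathstart \<gamma>" "\<And>s. s \<in> {0..1} \<Longrightarrow> h (s, 1) = pathfinish \<gamma>"
    then show ?thesis
      unfolding ends \<gamma>(2) by (rule that)
  qed
  have "\<exists>D. continuous_on ?I D \<and> D ` ?I \<subseteq> config (k j) \<and>
      (\<forall>t\<in>{0..1}. D (0, t) = \<delta> j t \<and> D (1, t) = \<delta>' j t \<and> D (t, 0) = base_config (k j) \<and>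
        D (t, 1) = base_config (k j) \<circ> end_perm (k j) (\<delta> j))"
    if j: "j \<in> {1..n}" for j
  proof (rule homotopic_pathsE)
    show "homotopic_paths (config (k j)) (\<delta> j) (\<delta>' j)" using \<delta>[OF j] by simp
    have ends: "pathstart (\<delta> j) = base_config (k j)"
      "pathfinish (\<delta> j) = base_config (k j) \<circ> end_perm (k j) (\<delta> j)"
      using d(1)[OF j] end_perm(2)[OF d(1)[OF j]] by (auto simp: geometric_braid_def)
    fix h
    assume "continuous_on ?I h" "h ` ?I \<subseteq> config (k j)"
      and "\<And>t. t \<in> {0..1} \<Longrightarrow> h (0, t) = \<delta> j t" "\<And>t. t \<in> {0..1} \<Longrightarrow> h (1, t) = \<delta>' j t"
      and "\<And>s. s \<in> {0..1} \<Longrightarrow> h (s, 0) = pathstart (\<delta> j)" "\<And>s. s \<in> {0..1} \<Longrightarrow> h (s, 1) = pathfinish (\<delta> j)"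
    then show ?thesis
      unfolding ends by (intro exI[of _ h]) blast
  qed
  then have "\<exists>D. \<forall>j\<in>{1..n}. continuous_on ?I (D j) \<and> D j ` ?I \<subseteq> config (k j) \<and>
      (\<forall>t\<in>{0..1}. D j (0, t) = \<delta> j t \<and> D j (1, t) = \<delta>' j t \<and> D j (t, 0) = base_config (k j) \<and>
        D j (t, 1) = base_config (k j) \<circ> end_perm (k j) (\<delta> j))"
    by (intro bchoice ballI)
  then obtain D where D: "\<And>j. j \<in> {1..n} \<Longrightarrow> continuous_on ?I (D j)" "\<And>j. j \<in> {1..n} \<Longrightarrow> D j ` ?I \<subseteq> config (k j)"
    and D0: "\<And>j t. j \<in> {1..n} \<Longrightarrow> t \<in> {0..1} \<Longrightarrow> D j (0, t) = \<delta> j t"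
    and D1: "\<And>j t. j \<in> {1..n} \<Longrightarrow> t \<in> {0..1} \<Longrightarrow> D j (1, t) = \<delta>' j t"
    and Dstart: "\<And>j t. j \<in> {1..n} \<Longrightarrow> t \<in> {0..1} \<Longrightarrow> D j (t, 0) = base_config (k j)"
    and Dfinish: "\<And>j t. j \<in> {1..n} \<Longrightarrow> t \<in> {0..1} \<Longrightarrow> D j (t, 1) = base_config (k j) \<circ> end_perm (k j) (\<delta> j)"
    by blast
  have "\<forall>\<^sub>F \<epsilon> in at_right 0. (\<forall>z\<in>?I. cable_point n k \<epsilon> (\<lambda>j. D j z) (G z) \<in> config N) \<and>
      left_to_right N (cable_base n k \<epsilon>)"
    unfolding N_def
    by (intro eventually_conj eventually_cable_base_left_to_right eventually_cable_in_config
        compact_Times compact_Icc G D)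
  then obtain e where e: "e > 0"
    and small: "\<And>\<epsilon> z. 0 < \<epsilon> \<Longrightarrow> \<epsilon> < e \<Longrightarrow> z \<in> ?I \<Longrightarrow> cable_point n k \<epsilon> (\<lambda>j. D j z) (G z) \<in> config N"
    and ltr: "\<And>\<epsilon>. 0 < \<epsilon> \<Longrightarrow> \<epsilon> < e \<Longrightarrow> left_to_right N (cable_base n k \<epsilon>)"
    unfolding eventually_at_right_field by blast
  show ?thesis
  proof (intro exI[of _ e] conjI e allI impI)
    fix \<epsilon> \<epsilon>' :: real
    assume "0 < \<epsilon> \<and> \<epsilon> < e \<and> 0 < \<epsilon>' \<and> \<epsilon>' < e"
    then have \<epsilon>: "0 < \<epsilon>" "\<epsilon> < e" "0 < \<epsilon>'" "\<epsilon>' < e" by auto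
    define E where "E = linepath \<epsilon> \<epsilon>'"
    have E: "0 < E s" "E s < e" if "s \<in> {0..1}" for s
    proof -
      have "E s \<in> closed_segment \<epsilon> \<epsilon>'"
        unfolding E_def using that by (rule linepath_in_path)
      then show "0 < E s" "E s < e" using \<epsilon> by (auto simp: closed_segment_eq_real_ivl split: if_splits)
    qed
    define S where "S = (\<lambda>s. slide (base_config N) (cable_base n k (E s)))"
    define C where "C = (\<lambda>s t. cable_point n k (E s) (\<lambda>j. D j (s, t)) (G (s, t)))"
    define R where "R = (\<lambda>s t. reversepath (S s) t \<circ> \<tau>)"
    define H where "H = (\<lambda>s. S s +++ C s +++ R s)"
    have Sp: "path (S s)" "path_image (S s) \<subseteq> config N" "pathstart (S s) = base_config N"
      "pathfinish (S s) = cable_base n k (E s)" if "s \<in> {0..1}" for s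
      unfolding S_def using slide_base ltr E that by auto
    have Rp: "path (R s)" "path_image (R s) \<subseteq> config N" "pathstart (R s) = cable_base n k (E s) \<circ> \<tau>"
      "pathfinish (R s) = base_config N \<circ> \<tau>" if "s \<in> {0..1}" for s
      unfolding R_def using Sp[OF that] path_relabel path_image_relabel[OF _ \<tau>]
      by (auto simp: relabel_ends relabel_reversepath)
    have Cends: "pathstart (C s) = cable_base n k (E s)" "pathfinish (C s) = cable_base n k (E s) \<circ> \<tau>"
      if s: "s \<in> {0..1}" for s
    proof -
      show "pathstart (C s) = cable_base n k (E s)"
        unfolding C_def pathstart_def cable_base_def
        by (rule cable_point_cong) (use Dstart Gends s in auto)
      have "pathfinish (C s) = cable_point n k (E s) (\<lambda>j. base_config (k j) \<circ> end_perm (k j) (\<delta> j)) (base_config n)"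
        unfolding C_def pathfinish_def
        by (rule cable_point_cong) (use Dfinish Gends s in auto)
      then show "pathfinish (C s) = cable_base n k (E s) \<circ> \<tau>"
        unfolding cable\<tau> cable_base_def .
    qed
    have contE: "continuous_on ?I (\<lambda>z. E (fst z))"
      unfolding E_def linepath_def by (intro continuous_intros)
    have "continuous_on ?I (\<lambda>z. cable_point n k (E (fst z)) (\<lambda>j. D j z) (G z))"
      by (rule continuous_on_cable_point[OF contE G(1) D(1)])
    then have contC: "continuous_on ?I (\<lambda>z. C (fst z) (snd z))"
      by (simp add: C_def)
    have "continuous_on ?I (\<lambda>z. cable_base n k (E (fst z)))"
      unfolding cable_base_def by (intro continuous_on_cable_point contE continuous_on_const)
    then have base: "continuous_on ?I (\<lambda>z. cable_base n k (E (fst z)) p)" for p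
      by (rule continuous_on_product_then_coordinatewise)
    have contS: "continuous_on ?I (\<lambda>z. S (fst z) (snd z))"
      unfolding S_def slide_def linepath_def
      by (intro continuous_on_coordinatewise_then_product continuous_intros base)
    have contR: "continuous_on ?I (\<lambda>z. R (fst z) (snd z))"
      unfolding R_def reversepath_def S_def slide_def linepath_def comp_def
      by (intro continuous_on_coordinatewise_then_product continuous_intros base)
    have contH: "continuous_on ?I (\<lambda>z. H (fst z) (snd z))"
      unfolding H_def
      by (intro continuous_on_homotopic_join_lemma[where p = S and q = "\<lambda>s. C s +++ R s"]
          continuous_on_homotopic_join_lemma contS contC contR)
        (simp_all add: Sp Rp Cends)
    have "path_image (C s) \<subseteq> config N" if "s \<in> {0..1}" for s
      unfolding path_image_def C_def using small E that by auto
    then have H: "path_image (H s) \<subseteq> config N" if "s \<in> {0..1}" for s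
      unfolding H_def using that Sp Rp by (intro subset_path_image_join) auto
    have Hends: "pathstart (H s) = base_config N" "pathfinish (H s) = base_config N \<circ> \<tau>" if "s \<in> {0..1}" for s
      unfolding H_def using that Sp Rp by auto
    have C0: "C 0 t = cable_path n k \<epsilon> \<delta> \<gamma> t" and C1: "C 1 t = cable_path n k \<epsilon>' \<delta>' \<gamma>' t" if "t \<in> {0..1}" for t
      unfolding C_def cable_path_eq_point
      using that by (auto simp: E_def linepath_def D0 D1 G0 G1 intro!: cable_point_cong)
    have H0: "H 0 t = standardize N (cable_path n k \<epsilon> \<delta> \<gamma>) t" if "t \<in> {0..1}" for t
      using C0 that unfolding H_def S_def R_def E_def
        standardize_eq[OF ltr[OF \<epsilon>(1,2)] \<tau> ends]
      by (auto simp: joinpaths_def linepath_def)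
    have H1: "H 1 t = standardize N (cable_path n k \<epsilon>' \<delta>' \<gamma>') t" if "t \<in> {0..1}" for t
      using C1 that unfolding H_def S_def R_def E_def
        standardize_eq[OF ltr[OF \<epsilon>(3,4)] \<tau> ends']
      by (auto simp: joinpaths_def linepath_def)
    have hom: "homotopic_paths (config N) (standardize N (cable_path n k \<epsilon> \<delta> \<gamma>)) (standardize N (cable_path n k \<epsilon>' \<delta>' \<gamma>'))"
      unfolding homotopic_paths
    proof (intro exI[of _ "\<lambda>z. H (fst z) (snd z)"] conjI ballI)
      show "(\<lambda>z. H (fst z) (snd z)) \<in> ?I \<rightarrow> config N"
        using H by (fastforce simp: path_image_def)
    qed (use contH H0 H1 Hends H0[of 0] H0[of 1] in \<open>auto simp: pathstart_def pathfinish_def\<close>)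
    have starts: "pathstart (standardize N (cable_path n k \<epsilon> \<delta> \<gamma>)) = base_config N"
      "pathfinish (standardize N (cable_path n k \<epsilon> \<delta> \<gamma>)) = base_config N \<circ> \<tau>"
      using Hends[of 0] H0[of 0] H0[of 1] by (simp_all add: pathstart_def pathfinish_def)
    show "isotopic (N, standardize N (cable_path n k \<epsilon> \<delta> \<gamma>)) (N, standardize N (cable_path n k \<epsilon>' \<delta>' \<gamma>'))"
      using hom starts homotopic_paths_imp_path[OF hom] homotopic_paths_imp_subset[OF hom]
        homotopic_paths_imp_pathstart[OF hom] homotopic_paths_imp_pathfinish[OF hom] N1 \<tau>
      by (auto simp: geometric_braid_def)
  qed
qed

lemma represents_imp_isotopic:
  assumes "represents n \<gamma> b" "represents n \<gamma>' b"
  shows "isotopic (n, \<gamma>) (n, \<gamma>')"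
  using assms Quotient3_rel[OF Quotient3_braid, of "(n, \<gamma>)" "(n, \<gamma>')"] isotopic_self
  unfolding represents_def by metis

lemma represents_isotopic:
  assumes "represents n \<gamma> b" "isotopic (n, \<gamma>) (n, \<gamma>')"
  shows "represents n \<gamma>' b"
  using assms abs_braid_eqI[of n \<gamma> \<gamma>'] unfolding represents_def by auto

lemma represents_strands: "\<exists>\<gamma>. represents (strands b) \<gamma> b"
  using braid_cases[of b] strands_abs unfolding represents_def by metis

lemma pure_braid_pathfinish:
  assumes "pure_braid b" "represents n \<gamma> b"
  shows "pathfinish \<gamma> = base_config n"
proof
  fix i
  have g: "geometric_braid n \<gamma>" and b: "b = abs_braid (n, \<gamma>)"
    using assms(2) by (auto simp: represents_def)
  have "pathfinish \<gamma> \<in> config n"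
    using g unfolding geometric_braid_def by blast
  then show "pathfinish \<gamma> i = base_config n i"
    using assms(1) pure_braid.abs_eq[OF isotopic_self[OF g]]
    by (auto simp: b base_config_def config_def)
qed

text \<open>
  Two choices of representatives and widths are compared by \<open>cables_isotopic\<close>. The bound on the
  widths depends on both choices, so an intermediate width of the first choice below both bounds is
  used. Uniqueness of the braid holds because the eventual statements share some \<open>\<epsilon>\<close>.
\<close>

lemma represents_cabled:
  assumes pure: "pure_braid b" and \<gamma>: "represents n \<gamma> b"
    and \<delta>: "\<And>i. i \<in> {1..n} \<Longrightarrow> represents (k i) (\<delta> i) (\<beta> i)"
    and k: "k = (\<lambda>i. strands (\<beta> i))"
  defines "N \<equiv> \<Sum>i\<in>{1..n}. k i"
  shows "\<forall>\<^sub>F \<epsilon> in at_right 0. represents N (standardize N (cable_path n k \<epsilon> \<delta> \<gamma>)) (cabled \<beta> b)"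
proof -
  have n: "strands b = n"
    using \<gamma> strands_abs by (auto simp: represents_def)
  let ?reps = "\<lambda>\<gamma> \<delta>. represents n \<gamma> b \<and> (\<forall>i\<in>{1..n}. represents (k i) (\<delta> i) (\<beta> i))"
  let ?P = "\<lambda>c. \<forall>\<gamma> \<delta>. ?reps \<gamma> \<delta> \<longrightarrow>
    (\<forall>\<^sub>F \<epsilon> in at_right 0. represents N (standardize N (cable_path n k \<epsilon> \<delta> \<gamma>)) c)"
  have iso: "\<exists>e>0. \<forall>\<epsilon> \<epsilon>'. 0 < \<epsilon> \<and> \<epsilon> < e \<and> 0 < \<epsilon>' \<and> \<epsilon>' < e \<longrightarrow>
      isotopic (N, standardize N (cable_path n k \<epsilon> \<delta> \<gamma>)) (N, standardize N (cable_path n k \<epsilon>' \<delta>' \<gamma>'))"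
    if "?reps \<gamma>' \<delta>'" for \<gamma>' \<delta>'
    unfolding N_def using that \<gamma> \<delta> pure_braid_pathfinish[OF pure \<gamma>]
    by (intro cables_isotopic represents_imp_isotopic) auto
  obtain e where e: "e > 0" "\<And>\<epsilon> \<epsilon>'. 0 < \<epsilon> \<Longrightarrow> \<epsilon> < e \<Longrightarrow> 0 < \<epsilon>' \<Longrightarrow> \<epsilon>' < e \<Longrightarrow>
      isotopic (N, standardize N (cable_path n k \<epsilon> \<delta> \<gamma>)) (N, standardize N (cable_path n k \<epsilon>' \<delta> \<gamma>))"
    using iso[of \<gamma> \<delta>] \<gamma> \<delta> by blast
  define c where "c = abs_braid (N, standardize N (cable_path n k (e/2) \<delta> \<gamma>))"
  have c: "represents N (standardize N (cable_path n k \<epsilon> \<delta> \<gamma>)) c" if "0 < \<epsilon>" "\<epsilon> < e" for \<epsilon>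
  proof (rule represents_isotopic)
    show "isotopic (N, standardize N (cable_path n k (e/2) \<delta> \<gamma>)) (N, standardize N (cable_path n k \<epsilon> \<delta> \<gamma>))"
      using e(1) that by (intro e(2)) auto
    then show "represents N (standardize N (cable_path n k (e/2) \<delta> \<gamma>)) c"
      by (simp add: represents_def c_def)
  qed
  have P: "?P c"
  proof (intro allI impI)
    fix \<gamma>' \<delta>' assume "?reps \<gamma>' \<delta>'"
    from iso[OF this] obtain e' where e': "e' > 0"
      "\<And>\<epsilon> \<epsilon>'. 0 < \<epsilon> \<Longrightarrow> \<epsilon> < e' \<Longrightarrow> 0 < \<epsilon>' \<Longrightarrow> \<epsilon>' < e' \<Longrightarrow>
        isotopic (N, standardize N (cable_path n k \<epsilon> \<delta> \<gamma>)) (N, standardize N (cable_path n k \<epsilon>' \<delta>' \<gamma>'))"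
      by blast
    have "represents N (standardize N (cable_path n k \<epsilon> \<delta>' \<gamma>')) c" if "0 < \<epsilon>" "\<epsilon> < e'" for \<epsilon>
      by (rule represents_isotopic[OF c e'(2)[of "min e e' / 2"]]) (use e(1) e'(1) that in auto)
    then show "\<forall>\<^sub>F \<epsilon> in at_right 0. represents N (standardize N (cable_path n k \<epsilon> \<delta>' \<gamma>')) c"
      unfolding eventually_at_right_field using e'(1) by blast
  qed
  have uniq: "c' = c" if "?P c'" for c'
  proof -
    have "?reps \<gamma> \<delta>" using \<gamma> \<delta> by blast
    then have "\<forall>\<^sub>F \<epsilon> in at_right 0. represents N (standardize N (cable_path n k \<epsilon> \<delta> \<gamma>)) c' \<and>
        represents N (standardize N (cable_path n k \<epsilon> \<delta> \<gamma>)) c"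
      using that P by (intro eventually_conj) blast+
    then have "\<exists>\<epsilon>. represents N (standardize N (cable_path n k \<epsilon> \<delta> \<gamma>)) c' \<and>
        represents N (standardize N (cable_path n k \<epsilon> \<delta> \<gamma>)) c"
      by (intro eventually_happens'[OF trivial_limit_at_right_real])
    then show ?thesis by (auto simp: represents_def)
  qed
  have "cabled \<beta> b = (THE c. ?P c)"
    unfolding cabled_def Let_def n N_def k ..
  also have "\<dots> = c"
    using P uniq by (rule the_equality)
  finally show ?thesis
    using P \<gamma> \<delta> by blast
qed


section \<open>Cabling conjugate pure braids\<close>

lemma config_comp_inj:
  assumes "x \<in> config N" "\<sigma> permutes {1..N}" "\<tau> permutes {1..N}" "x \<circ> \<sigma> = x \<circ> \<tau>"
  shows "\<sigma> = \<tau>"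
proof
  fix i
  show "\<sigma> i = \<tau> i"
  proof (cases "i \<in> {1..N}")
    case True
    then have "\<sigma> i \<in> {1..N}" "\<tau> i \<in> {1..N}"
      using assms by (meson permutes_in_image)+
    then show ?thesis
      using assms(1) fun_cong[OF assms(4), of i] by (auto simp: config_def dest: inj_onD)
  qed (use assms in \<open>auto simp: permutes_not_in\<close>)
qed

lemma represents_homotopic:
  assumes "represents n \<gamma> b" "homotopic_paths (config n) \<gamma> \<gamma>'"
  shows "represents n \<gamma>' b"
proof (rule represents_isotopic[OF assms(1)])
  have "geometric_braid n \<gamma>" using assms(1) by (simp add: represents_def)
  moreover from this have "geometric_braid n \<gamma>'"
    unfolding geometric_braid_def
    using homotopic_paths_imp_path[OF assms(2)] homotopic_paths_imp_subset[OF assms(2)]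
      homotopic_paths_imp_pathstart[OF assms(2)] homotopic_paths_imp_pathfinish[OF assms(2)]
    by auto
  ultimately show "isotopic (n, \<gamma>) (n, \<gamma>')" using assms(2) by simp
qed

lemma end_perm_const: "end_perm n (\<lambda>t. base_config n) = id"
  by (rule end_perm_eqI) (auto simp: permutes_id pathfinish_def)

text \<open>
  The inserted braids are at rest during the first quarter and the second half of the time, while
  the core runs through \<open>a\<inverse>\<close> and \<open>a\<close>. The bracketing is that of \<open>(1 b) 1\<close>, so the group laws
  show that the braid is unchanged.
\<close>

lemma represents_padded:
  assumes "represents n \<delta> b"
  shows "represents n (((\<lambda>t. base_config n) +++ \<delta>) +++ (\<lambda>t. base_config n \<circ> end_perm n \<delta>)) b"
proof -
  let ?c = "\<lambda>t. base_config n"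
  have \<delta>: "geometric_braid n \<delta>" and b: "b = abs_braid (n, \<delta>)"
    using assms by (auto simp: represents_def)
  have n: "1 \<le> n" using \<delta> by (simp add: geometric_braid_def)
  interpret group "braid_group n" using n by (rule group_braid_group)
  note c = geometric_braid_const[OF n]
  note s = geometric_braid_stack[OF c \<delta>]
  have "b \<in> carrier (braid_group n)"
    using strands_abs[OF \<delta>] by (simp add: b braid_group_def)
  then have "\<one>\<^bsub>braid_group n\<^esub> \<otimes>\<^bsub>braid_group n\<^esub> b \<otimes>\<^bsub>braid_group n\<^esub> \<one>\<^bsub>braid_group n\<^esub> = b"
    by simp
  then have "abs_braid (n, stack n (stack n ?c \<delta>) ?c) = b"
    using s c \<delta> by (simp add: braid_group_def trivial_braid_def b braid_mult_abs)
  moreover have "stack n (stack n ?c \<delta>) ?c = (?c +++ \<delta>) +++ (\<lambda>t. base_config n \<circ> end_perm n \<delta>)"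
    by (simp add: stack_def[of n "stack n ?c \<delta>"] s(2) end_perm_const) (simp add: stack_def end_perm_const)
  ultimately show ?thesis
    using geometric_braid_stack(1)[OF s(1) c] by (simp add: represents_def)
qed

text \<open>
  For pure \<open>b\<close> all three parts of \<open>(a\<inverse> b) a\<close> carry the same relabelling \<open>\<sigma>\<close>, because both \<open>a\<inverse>\<close>
  and \<open>a\<inverse> b\<close> have the permutation inverse to that of \<open>a\<close>.
\<close>

lemma represents_conjugate:
  assumes \<gamma>: "represents n \<gamma> b" and \<eta>: "represents n \<eta> a" and pure: "pure_braid b"
  defines "\<sigma> \<equiv> Hilbert_Choice.inv (end_perm n \<eta>)"
  shows "represents n (((\<lambda>t. reversepath \<eta> t \<circ> \<sigma>) +++ (\<lambda>t. \<gamma> t \<circ> \<sigma>)) +++ (\<lambda>t. \<eta> t \<circ> \<sigma>))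
    (inv\<^bsub>braid_group n\<^esub> a \<otimes>\<^bsub>braid_group n\<^esub> b \<otimes>\<^bsub>braid_group n\<^esub> a)"
proof -
  let ?d = "\<lambda>t. reversepath \<eta> t \<circ> \<sigma>"
  have g: "geometric_braid n \<gamma>" "geometric_braid n \<eta>"
    and ab: "b = abs_braid (n, \<gamma>)" "a = abs_braid (n, \<eta>)"
    using \<gamma> \<eta> by (auto simp: represents_def)
  have n: "1 \<le> n" using g by (simp add: geometric_braid_def)
  interpret group "braid_group n" using n by (rule group_braid_group)
  note r = geometric_braid_reverse[OF g(2), folded \<sigma>_def]
  note s = geometric_braid_stack[OF r(1) g(1)]
  have id: "end_perm n \<gamma> = id"
    by (rule end_perm_eqI) (simp_all add: permutes_id pure_braid_pathfinish[OF pure \<gamma>])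
  have "abs_braid (n, ?d) \<otimes>\<^bsub>braid_group n\<^esub> a = \<one>\<^bsub>braid_group n\<^esub>"
    using abs_braid_eqI[OF _ geometric_braid_const[OF n]] r(3)
    by (simp add: ab braid_group_def trivial_braid_def braid_mult_abs[OF r(1) g(2)])
  then have "inv\<^bsub>braid_group n\<^esub> a = abs_braid (n, ?d)"
    using strands_abs g(2) r(1) by (intro inv_equality) (auto simp: ab braid_group_def)
  then have "inv\<^bsub>braid_group n\<^esub> a \<otimes>\<^bsub>braid_group n\<^esub> b \<otimes>\<^bsub>braid_group n\<^esub> a
      = abs_braid (n, stack n (stack n ?d \<gamma>) \<eta>)"
    using g r(1) s(1) by (simp add: ab braid_group_def braid_mult_abs)
  moreover have "stack n (stack n ?d \<gamma>) \<eta> = (?d +++ (\<lambda>t. \<gamma> t \<circ> \<sigma>)) +++ (\<lambda>t. \<eta> t \<circ> \<sigma>)"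
    by (simp add: stack_def[of n "stack n ?d \<gamma>"] s(2) r(2) id) (simp add: stack_def r(2))
  ultimately show ?thesis
    using geometric_braid_stack(1)[OF s(1) g(2)] by (simp add: represents_def)
qed

lemma homotopic_regroup:
  fixes a b c d e :: "real \<Rightarrow> 'a::topological_space"
  assumes "path a" "path_image a \<subseteq> S" "path b" "path_image b \<subseteq> S" "path c" "path_image c \<subseteq> S"
    "path d" "path_image d \<subseteq> S" "path e" "path_image e \<subseteq> S"
    and "pathfinish a = pathstart b" "pathfinish b = pathstart c" "pathfinish c = pathstart d"
    "pathfinish d = pathstart e"
  shows "homotopic_paths S (a +++ ((b +++ c) +++ d) +++ e) ((a +++ b) +++ c +++ d +++ e)"
proof -
  have 1: "homotopic_paths S (a +++ ((b +++ c) +++ d) +++ e) (a +++ (b +++ c) +++ d +++ e)"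
    using assms
    by (intro homotopic_paths_join homotopic_paths_sym[OF homotopic_paths_assoc])
      (auto simp: subset_path_image_join)
  have 2: "homotopic_paths S (a +++ (b +++ c) +++ d +++ e) (a +++ b +++ c +++ d +++ e)"
    using assms
    by (intro homotopic_paths_join homotopic_paths_sym[OF homotopic_paths_assoc])
      (auto simp: subset_path_image_join)
  have 3: "homotopic_paths S (a +++ b +++ c +++ d +++ e) ((a +++ b) +++ c +++ d +++ e)"
    using assms
    by (intro homotopic_paths_assoc) (auto simp: subset_path_image_join)
  show ?thesis
    by (rule homotopic_paths_trans[OF 1 homotopic_paths_trans[OF 2 3]])
qed

text \<open>
  Let \<open>\<sigma> = end_perm n \<eta>\<close>. The strand of \<open>a\<inverse> b a\<close> that carries \<open>\<beta> (\<sigma> i)\<close> follows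
  strand \<open>i\<close> of \<open>b\<close> in the middle, so the middle part of the cable is the cable of \<open>b\<close> with \<open>\<beta> \<circ> \<sigma>\<close> inserted, up to numbering. The outer
  parts are a cable of \<open>a\<close> without inserted braids and its reverse; they only change the base point.
\<close>

lemma conjugate_cabled:
  assumes \<gamma>: "represents n \<gamma> b" and \<eta>: "represents n \<eta> a"
    and pure: "pure_braid b" "pure_braid b'"
    and b': "b' = inv\<^bsub>braid_group n\<^esub> a \<otimes>\<^bsub>braid_group n\<^esub> b \<otimes>\<^bsub>braid_group n\<^esub> a"
  shows "conjugate (cabled (\<beta> \<circ> end_perm n \<eta>) b) (cabled \<beta> b')"
proof -
  define \<sigma> where "\<sigma> = end_perm n \<eta>"
  define \<sigma>i where "\<sigma>i = Hilbert_Choice.inv \<sigma>"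
  define k where "k = (\<lambda>i. strands (\<beta> i))"
  define N where "N = (\<Sum>i\<in>{1..n}. k i)"
  have g: "geometric_braid n \<gamma>" "geometric_braid n \<eta>"
    using \<gamma> \<eta> by (auto simp: represents_def)
  have \<sigma>: "\<sigma> permutes {1..n}" and \<eta>1: "pathfinish \<eta> = base_config n \<circ> \<sigma>"
    using end_perm[OF g(2)] by (auto simp: \<sigma>_def)
  have \<sigma>i: "\<sigma>i permutes {1..n}" "\<sigma> \<circ> \<sigma>i = id"
    unfolding \<sigma>i_def using \<sigma> by (simp_all add: permutes_inv permutes_inv_o)
  have N\<sigma>: "(\<Sum>i\<in>{1..n}. (k \<circ> \<sigma>) i) = N"
    unfolding N_def using sum.permute[OF \<sigma>, of k] by simp
  have "\<forall>i. \<exists>\<delta>. represents (k i) \<delta> (\<beta> i)"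
    unfolding k_def using represents_strands by blast
  then obtain \<delta> where \<delta>: "\<And>i. represents (k i) (\<delta> i) (\<beta> i)" by metis
  have d: "geometric_braid (k i) (\<delta> i)" for i
    using \<delta> by (auto simp: represents_def)
  have N1: "1 \<le> N"
    using g(1) d[of 1] member_le_sum[of 1 "{1..n}" k] by (simp add: geometric_braid_def N_def)
  define \<gamma>' where "\<gamma>' = ((\<lambda>t. reversepath \<eta> t \<circ> \<sigma>i) +++ (\<lambda>t. \<gamma> t \<circ> \<sigma>i)) +++ (\<lambda>t. \<eta> t \<circ> \<sigma>i)"
  define \<delta>' where "\<delta>' = (\<lambda>i. ((\<lambda>t. base_config (k i)) +++ \<delta> i) +++ (\<lambda>t. base_config (k i) \<circ> end_perm (k i) (\<delta> i)))"
  have \<gamma>': "represents n \<gamma>' b'"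
    unfolding \<gamma>'_def b' \<sigma>i_def \<sigma>_def using \<gamma> \<eta> pure(1) by (rule represents_conjugate)
  have \<delta>': "represents (k i) (\<delta>' i) (\<beta> i)" for i
    unfolding \<delta>'_def using \<delta> by (rule represents_padded)
  let ?A = "\<lambda>\<epsilon> t. cable_point n k \<epsilon> (\<lambda>j. base_config (k j)) (\<eta> t \<circ> \<sigma>i)"
  let ?B = "\<lambda>\<epsilon>. cable_path n (k \<circ> \<sigma>) \<epsilon> (\<delta> \<circ> \<sigma>) \<gamma>"
  have paths: "continuous_on {0..1} \<gamma>" "\<gamma> ` {0..1} \<subseteq> config n"
    "continuous_on {0..1} (\<lambda>t. \<eta> t \<circ> \<sigma>i)" "(\<lambda>t. \<eta> t \<circ> \<sigma>i) ` {0..1} \<subseteq> config n"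
    "\<And>i. continuous_on {0..1} (\<delta> i)" "\<And>i. \<delta> i ` {0..1} \<subseteq> config (k i)"
    using g d path_relabel path_image_relabel[OF _ \<sigma>i(1)]
    unfolding geometric_braid_def path_def path_image_def by blast+
  have "\<forall>\<^sub>F \<epsilon> in at_right 0. represents N (standardize N (?B \<epsilon>)) (cabled (\<beta> \<circ> \<sigma>) b)"
    using represents_cabled[OF pure(1) \<gamma>, where k = "k \<circ> \<sigma>" and \<delta> = "\<delta> \<circ> \<sigma>" and \<beta> = "\<beta> \<circ> \<sigma>"] \<delta>
    unfolding N\<sigma> by (simp add: k_def comp_def)
  moreover have "\<forall>\<^sub>F \<epsilon> in at_right 0. represents N (standardize N (cable_path n k \<epsilon> \<delta>' \<gamma>')) (cabled \<beta> b')"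
    unfolding N_def by (rule represents_cabled[OF pure(2) \<gamma>' \<delta>' k_def])
  moreover have "\<forall>\<^sub>F \<epsilon> in at_right 0. left_to_right N (cable_base n (k \<circ> \<sigma>) \<epsilon>)"
    using eventually_cable_base_left_to_right[where n = n and k = "k \<circ> \<sigma>"] unfolding N\<sigma> .
  moreover have "\<forall>\<^sub>F \<epsilon> in at_right 0. left_to_right N (cable_base n k \<epsilon>)"
    using eventually_cable_base_left_to_right[where n = n and k = k] unfolding N_def .
  moreover have "\<forall>\<^sub>F \<epsilon> in at_right 0. \<forall>t\<in>{0..1}. ?A \<epsilon> t \<in> config N"
    unfolding N_def
    by (rule eventually_cable_in_config[where D = "\<lambda>j t. base_config (k j)", OF compact_Icc paths(3,4)])
      (auto simp: base_in_config)
  moreover have "\<forall>\<^sub>F \<epsilon> in at_right 0. \<forall>t\<in>{0..1}. ?B \<epsilon> t \<in> config N"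
    unfolding N\<sigma>[symmetric] cable_path_eq_point
    by (rule eventually_cable_in_config[where D = "\<delta> \<circ> \<sigma>", OF compact_Icc paths(1,2)])
      (simp_all add: paths(5,6))
  ultimately have "\<forall>\<^sub>F \<epsilon> in at_right 0.
      represents N (standardize N (?B \<epsilon>)) (cabled (\<beta> \<circ> \<sigma>) b) \<and>
      represents N (standardize N (cable_path n k \<epsilon> \<delta>' \<gamma>')) (cabled \<beta> b') \<and>
      left_to_right N (cable_base n (k \<circ> \<sigma>) \<epsilon>) \<and> left_to_right N (cable_base n k \<epsilon>) \<and>
      (\<forall>t\<in>{0..1}. ?A \<epsilon> t \<in> config N) \<and> (\<forall>t\<in>{0..1}. ?B \<epsilon> t \<in> config N)"
    by (intro eventually_conj)
  \<comment> \<open>One width that is small enough for all the cables involved.\<close>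
  from eventually_happens'[OF trivial_limit_at_right_real this] obtain \<epsilon>
    where repB: "represents N (standardize N (?B \<epsilon>)) (cabled (\<beta> \<circ> \<sigma>) b)"
      and repB': "represents N (standardize N (cable_path n k \<epsilon> \<delta>' \<gamma>')) (cabled \<beta> b')"
      and ltr: "left_to_right N (cable_base n (k \<circ> \<sigma>) \<epsilon>)" "left_to_right N (cable_base n k \<epsilon>)"
      and config: "\<forall>t\<in>{0..1}. ?A \<epsilon> t \<in> config N" "\<forall>t\<in>{0..1}. ?B \<epsilon> t \<in> config N"
    by blast
  \<comment> \<open>\<open>A\<close> is the parallel cable of \<open>a\<close>, with the numbering of the cable of \<open>b'\<close>; \<open>B\<close> is the cable of
    \<open>b\<close>, with its own numbering. The renumbering is \<open>\<rho>\<close>.\<close>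
  define A where "A = ?A \<epsilon>"
  define B where "B = ?B \<epsilon>"
  define x where "x = cable_base n (k \<circ> \<sigma>) \<epsilon>"
  define y where "y = cable_base n k \<epsilon>"
  have perms: "\<And>i. end_perm (k i) (\<delta> i) permutes {1..k i}"
    using end_perm(1)[OF d] .
  obtain \<tau> where \<tau>: "\<tau> permutes {1..N}"
    and cable\<tau>: "\<And>\<epsilon> D x. cable_point n (k \<circ> \<sigma>) \<epsilon> (\<lambda>j. D j \<circ> end_perm ((k \<circ> \<sigma>) j) ((\<delta> \<circ> \<sigma>) j)) x
      = cable_point n (k \<circ> \<sigma>) \<epsilon> D x \<circ> \<tau>"
  proof (rule cable_point_inner_relabel[of n "\<lambda>j. end_perm ((k \<circ> \<sigma>) j) ((\<delta> \<circ> \<sigma>) j)" "k \<circ> \<sigma>"])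
    show "end_perm ((k \<circ> \<sigma>) j) ((\<delta> \<circ> \<sigma>) j) permutes {1..(k \<circ> \<sigma>) j}" for j
      using perms by simp
  qed (unfold N\<sigma>, rule that)
  obtain \<tau>' where \<tau>': "\<tau>' permutes {1..N}"
    and cable\<tau>': "\<And>\<epsilon> D x. cable_point n k \<epsilon> (\<lambda>j. D j \<circ> end_perm (k j) (\<delta> j)) x = cable_point n k \<epsilon> D x \<circ> \<tau>'"
    using cable_point_inner_relabel[of n "\<lambda>j. end_perm (k j) (\<delta> j)" k] perms
    unfolding N_def by blast
  obtain \<rho> where \<rho>: "\<rho> permutes {1..N}"
    and cable\<rho>: "\<And>\<epsilon> D x. cable_point n k \<epsilon> D (x \<circ> \<sigma>i) = cable_point n (k \<circ> \<sigma>) \<epsilon> (D \<circ> \<sigma>) x \<circ> \<rho>"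
    using cable_point_outer_relabel[OF \<sigma>, of k] unfolding N_def \<sigma>i_def by blast
  have "\<And>j. geometric_braid ((k \<circ> \<sigma>) j) ((\<delta> \<circ> \<sigma>) j)"
    using d by simp
  note Bends = cable_path_ends[OF g(1) pure_braid_pathfinish[OF pure(1) \<gamma>] this cable\<tau>,
      of \<epsilon>, folded B_def x_def]
  have x\<rho>: "cable_point n k \<epsilon> (\<lambda>j. base_config (k j)) (base_config n \<circ> \<sigma>i) = x \<circ> \<rho>"
    unfolding cable\<rho> x_def cable_base_def by (simp add: comp_def)
  have xconf: "x \<in> config N"
    using config(2)[THEN bspec, of 0] Bends(1) unfolding pathstart_def B_def by simp
  \<comment> \<open>Both sides describe the end of the middle part of the cable of \<open>b'\<close>.\<close>
  have comm: "\<tau> \<circ> \<rho> = \<rho> \<circ> \<tau>'"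
  proof (rule config_comp_inj[OF xconf])
    have "x \<circ> \<tau> \<circ> \<rho> =
        cable_point n k \<epsilon> (\<lambda>j. base_config (k j) \<circ> end_perm (k j) (\<delta> j)) (base_config n \<circ> \<sigma>i)"
      unfolding cable\<rho> x_def cable_base_def cable\<tau>[symmetric] by (simp add: comp_def)
    also have "\<dots> = x \<circ> \<rho> \<circ> \<tau>'"
      unfolding cable\<tau>' x\<rho> ..
    finally show "x \<circ> (\<tau> \<circ> \<rho>) = x \<circ> (\<rho> \<circ> \<tau>')"
      by (simp add: o_assoc)
  qed (use \<tau> \<tau>' \<rho> permutes_compose in blast)+
  have Bp: "path B" "path_image B \<subseteq> config N"
    using config(2) continuous_on_cable_point[OF continuous_on_const[of _ \<epsilon>] paths(1), where n = n and D = "\<delta> \<circ> \<sigma>" and k = "k \<circ> \<sigma>"] paths(5)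
    unfolding path_def path_image_def B_def cable_path_eq_point by auto
  have Ap: "path A" "path_image A \<subseteq> config N"
    using config(1) continuous_on_cable_point[OF continuous_on_const[of _ \<epsilon>] paths(3), where n = n and D = "\<lambda>j t. base_config (k j)" and k = k]
    unfolding path_def path_image_def A_def by auto
  have "pathstart A = cable_point n k \<epsilon> (\<lambda>j. base_config (k j)) (pathstart \<eta> \<circ> \<sigma>i)"
    "pathfinish A = cable_point n k \<epsilon> (\<lambda>j. base_config (k j)) (pathfinish \<eta> \<circ> \<sigma>i)"
    by (simp_all add: A_def pathstart_def pathfinish_def)
  moreover have "pathstart \<eta> = base_config n" using g(2) by (simp add: geometric_braid_def)
  moreover have "pathfinish \<eta> \<circ> \<sigma>i = base_config n" using \<sigma>i(2) by (simp add: \<eta>1 o_assoc[symmetric])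
  ultimately have Aends: "pathstart A = x \<circ> \<rho>" "pathfinish A = y"
    using x\<rho> by (simp_all add: y_def cable_base_def)
  note Sx = slide_base[OF ltr(1), folded x_def] and Sy = slide_base[OF ltr(2), folded y_def]
  define Sx where "Sx = slide (base_config N) x"
  define Sy where "Sy = slide (base_config N) y"
  note Sx = Sx[folded Sx_def] and Sy = Sy[folded Sy_def]
  let ?B\<rho> = "\<lambda>t. B t \<circ> \<rho>" and ?A\<tau> = "\<lambda>t. A t \<circ> \<tau>'" and ?R = "\<lambda>t. reversepath Sy t \<circ> \<tau>'"
  let ?v = "Sy +++ reversepath A"
  have P': "cable_path n k \<epsilon> \<delta>' \<gamma>' = (reversepath A +++ ?B\<rho>) +++ ?A\<tau>"
  proof -
    have "cable_path n k \<epsilon> (\<lambda>i t. base_config (k i)) (\<lambda>t. reversepath \<eta> t \<circ> \<sigma>i) = reversepath A"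
      by (simp add: cable_path_eq_point A_def reversepath_def)
    moreover have "cable_path n k \<epsilon> \<delta> (\<lambda>t. \<gamma> t \<circ> \<sigma>i) = ?B\<rho>"
      unfolding cable_path_eq_point B_def cable\<rho> by (simp add: comp_def)
    moreover have "cable_path n k \<epsilon> (\<lambda>i t. base_config (k i) \<circ> end_perm (k i) (\<delta> i)) (\<lambda>t. \<eta> t \<circ> \<sigma>i) = ?A\<tau>"
      unfolding cable_path_eq_point A_def cable\<tau>' ..
    ultimately show ?thesis
      unfolding \<delta>'_def \<gamma>'_def by (simp add: cable_path_join)
  qed
  have rel: "path ?B\<rho>" "path_image ?B\<rho> \<subseteq> config N" "path ?A\<tau>" "path_image ?A\<tau> \<subseteq> config N"
    "path ?R" "path_image ?R \<subseteq> config N"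
    using Ap Bp Sy path_relabel path_image_relabel[OF _ \<rho>] path_image_relabel[OF _ \<tau>']
    by (auto simp: relabel_reversepath)
  have relends: "pathstart ?B\<rho> = x \<circ> \<rho>" "pathfinish ?B\<rho> = x \<circ> \<rho> \<circ> \<tau>'"
    "pathstart ?A\<tau> = x \<circ> \<rho> \<circ> \<tau>'" "pathfinish ?A\<tau> = y \<circ> \<tau>'" "pathstart ?R = y \<circ> \<tau>'"
    using Aends Bends Sy comm by (simp_all add: relabel_ends o_assoc[symmetric])
  have std: "standardize N (cable_path n k \<epsilon> \<delta>' \<gamma>') = Sy +++ ((reversepath A +++ ?B\<rho>) +++ ?A\<tau>) +++ ?R"
    unfolding P' Sy_def
    by (rule standardize_eq[OF _ \<tau>']) (use ltr Aends relends in \<open>simp_all add: y_def\<close>)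
  have hom: "homotopic_paths (config N) (standardize N (cable_path n k \<epsilon> \<delta>' \<gamma>'))
      (?v +++ ?B\<rho> +++ ?A\<tau> +++ ?R)"
    unfolding std
    using Sy Ap rel Aends relends by (intro homotopic_regroup) auto
  have "?A\<tau> +++ ?R = (\<lambda>t. reversepath ?v t \<circ> \<tau>')"
    using Sy Aends by (simp add: reversepath_joinpaths relabel_join)
  then have repB'': "represents N (?v +++ ?B\<rho> +++ (\<lambda>t. reversepath ?v t \<circ> \<tau>')) (cabled \<beta> b')"
    using represents_homotopic[OF repB' hom] by simp
  have stdB: "standardize N (?B \<epsilon>) = Sx +++ B +++ (\<lambda>t. reversepath Sx t \<circ> \<tau>)"
    unfolding Sx_def B_def[symmetric]
    by (rule standardize_eq[OF _ \<tau>]) (use ltr Bends in \<open>simp_all add: x_def\<close>)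
  have "conjugate (abs_braid (N, Sx +++ B +++ (\<lambda>t. reversepath Sx t \<circ> \<tau>)))
      (abs_braid (N, ?v +++ ?B\<rho> +++ (\<lambda>t. reversepath ?v t \<circ> \<tau>')))"
    by (rule conjugate_transport[OF N1 \<tau> \<tau>' \<rho> comm])
      (use Sx Sy Ap Bp Aends Bends in \<open>simp_all add: subset_path_image_join\<close>)
  then show ?thesis
    using repB repB'' unfolding stdB by (simp add: represents_def \<sigma>_def)
qed

theorem proposition1:
  fixes n :: nat and b b' :: braid and \<beta> :: "nat \<Rightarrow> braid" and g :: "braid \<Rightarrow> 'a"
  assumes "n \<ge> 3"
    and "b \<in> carrier (braid_group n)" and "b' \<in> carrier (braid_group n)"
    and "pure_braid b" and "pure_braid b'"
    and "conjugate b b'"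
    and "conjugacy_invariant g"
  shows "cable_invariants \<beta> g b = cable_invariants \<beta> g b'"
proof -
  have n: "strands b = n" "strands b' = n"
    using assms(2,3) by (auto simp: braid_group_def)
  obtain a where a: "strands a = n"
    "b' = inv\<^bsub>braid_group n\<^esub> a \<otimes>\<^bsub>braid_group n\<^esub> b \<otimes>\<^bsub>braid_group n\<^esub> a"
    using assms(6) n unfolding conjugate_def by (auto simp: braid_group_def)
  obtain \<gamma> \<eta> where rep: "represents n \<gamma> b" "represents n \<eta> a"
    using represents_strands n(1) a(1) by metis
  define \<sigma> where "\<sigma> = end_perm n \<eta>"
  have \<sigma>: "\<sigma> permutes {1..n}"
    using rep(2) end_perm(1) unfolding \<sigma>_def represents_def by blast
  let ?P = "{\<pi>. \<pi> permutes {1..n}}" and ?f = "\<lambda>\<pi>. g (cabled (\<beta> \<circ> \<pi>) b)"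
  have "g (cabled (\<beta> \<circ> \<pi>) b') = ?f (\<pi> \<circ> \<sigma>)" for \<pi>
    using conjugate_cabled[OF rep assms(4,5) a(2), of "\<beta> \<circ> \<pi>"] assms(7)
    unfolding conjugacy_invariant_def \<sigma>_def by (simp add: o_assoc)
  then have "cable_invariants \<beta> g b' = image_mset ?f (image_mset (\<lambda>\<pi>. \<pi> \<circ> \<sigma>) (mset_set ?P))"
    unfolding cable_invariants_def n by (simp add: multiset.map_comp comp_def)
  also have "image_mset (\<lambda>\<pi>. \<pi> \<circ> \<sigma>) (mset_set ?P) = mset_set ?P"
  proof -
    have cancel: "\<pi> \<circ> \<sigma> \<circ> Hilbert_Choice.inv \<sigma> = \<pi>" "\<pi> \<circ> Hilbert_Choice.inv \<sigma> \<circ> \<sigma> = \<pi>" for \<pi> :: "nat \<Rightarrow> nat"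
      using permutes_inv_o[OF \<sigma>] by (simp_all add: o_assoc[symmetric])
    have "bij_betw (\<lambda>\<pi>. \<pi> \<circ> \<sigma>) ?P ?P"
      by (rule bij_betw_byWitness[where f' = "\<lambda>\<pi>. \<pi> \<circ> Hilbert_Choice.inv \<sigma>"])
        (use cancel permutes_compose[OF \<sigma>] permutes_compose[OF permutes_inv[OF \<sigma>]] in auto)
    then show ?thesis
      by (simp add: bij_betw_def image_mset_mset_set)
  qed
  finally show ?thesis
    unfolding cable_invariants_def n ..
qed

end
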